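(* Let $G$ be a group. The following properties are equivalent: (a) $\nu(G)$ is a BFC-group; (b) the set of all commutators $\{[\alpha,\beta]\mid \alpha,\beta\in\nu(G)\}$ is finite; (c) the derived subgroup $\nu(G)'$ is finite; (d) the non-abelian tensor square $[G,G^{\varphi}]$ is finite; (e) $G$ is a BFC-group and $G^{ab}\otimes_{\mathbb{Z}}G^{ab}$ is finite; (f) the set of tensors $T_{\otimes}(G)=\{[g,h^{\varphi}]\mid g,h\in G\}\subseteq\nu(G)$ is finite.
   Context: Let $G^{\varphi}$ be an extra copy of $G$, isomorphic via $\varphi:G\to G^{\varphi}$, $g\mapsto g^{\varphi}$. The group $\nu(G)$ is the quotient of the free product $G*G^{\varphi}$ by the relations $[g_1,g_2^{\varphi}]^{g_3}=[g_1^{g_3},(g_2^{g_3})^{\varphi}]=[g_1,g_2^{\varphi}]^{g_3^{\varphi}}$ for all $g_1,g_2,g_3\in G$, where $[x,y]=x^{-1}y^{-1}xy$ and $x^y=y^{-1}xy$. The subgroup $[G,G^{\varphi}]=\langle[g,h^{\varphi}]\mid g,h\in G\rangle$ of $\nu(G)$ is canonically isomorphic to the non-abelian tensor square $G\otimes G$ (with all actions given by conjugation) via $g\otimes h\mapsto[g,h^{\varphi}]$, and is called the non-abelian tensor square. $G^{ab}=G/G'$ is the abelianization, where $G'$ is the derived subgroup. A group is a BFC-group if there is a finite bound on the sizes of its conjugacy classes, i.e. there is a positive integer $d$ such that every conjugacy class has at most $d$ elements. *)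

theory Defs
  imports "HOL-Algebra.Algebra"
begin

section \<open>Commutators, conjugacy classes, BFC-groups\<close>

text \<open>The conventions are $x^y = y^{-1}xy$ and $[x,y] = x^{-1}y^{-1}xy$.  The library's
  \<^const>\<open>derived\<close> is generated by the elements $xyx^{-1}y^{-1}$ instead, which are the
  commutators $[x^{-1},y^{-1}]$, so it is the same subgroup.\<close>

definition conjugate :: "('a, 'm) monoid_scheme \<Rightarrow> 'a \<Rightarrow> 'a \<Rightarrow> 'a" where
  "conjugate G x y = inv\<^bsub>G\<^esub> y \<otimes>\<^bsub>G\<^esub> x \<otimes>\<^bsub>G\<^esub> y"

definition commutator :: "('a, 'm) monoid_scheme \<Rightarrow> 'a \<Rightarrow> 'a \<Rightarrow> 'a" where
  "commutator G x y = inv\<^bsub>G\<^esub> x \<otimes>\<^bsub>G\<^esub> inv\<^bsub>G\<^esub> y \<otimes>\<^bsub>G\<^esub> x \<otimes>\<^bsub>G\<^esub> y"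

definition conjugacy_class :: "('a, 'm) monoid_scheme \<Rightarrow> 'a \<Rightarrow> 'a set" where
  "conjugacy_class G x = {conjugate G x y | y. y \<in> carrier G}"

definition BFC_group :: "('a, 'm) monoid_scheme \<Rightarrow> bool" where
  "BFC_group G \<longleftrightarrow> group G \<and>
     (\<exists>d::nat. d > 0 \<and>
        (\<forall>x\<in>carrier G. finite (conjugacy_class G x) \<and> card (conjugacy_class G x) \<le> d))"

lemma (in group) conjugate_closed [simp]:
  "\<lbrakk>x \<in> carrier G; y \<in> carrier G\<rbrakk> \<Longrightarrow> conjugate G x y \<in> carrier G"
  by (simp add: conjugate_def)

lemma (in group) commutator_closed [simp]:
  "\<lbrakk>x \<in> carrier G; y \<in> carrier G\<rbrakk> \<Longrightarrow> commutator G x y \<in> carrier G"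
  by (simp add: commutator_def)

lemma (in group) derived_eq_generate_commutators:
  "derived G (carrier G) = generate G {commutator G x y | x y. x \<in> carrier G \<and> y \<in> carrier G}"
proof -
  have "derived_set G (carrier G) = {commutator G x y | x y. x \<in> carrier G \<and> y \<in> carrier G}"
  proof (intro equalityI subsetI)
    fix c assume "c \<in> derived_set G (carrier G)"
    then obtain x y where xy: "x \<in> carrier G" "y \<in> carrier G"
      and c: "c = x \<otimes> y \<otimes> inv x \<otimes> inv y" by auto
    then have "c = commutator G (inv x) (inv y)" by (simp add: commutator_def)
    with xy show "c \<in> {commutator G x y | x y. x \<in> carrier G \<and> y \<in> carrier G}"
      using inv_closed by blast
  next
    fix c assume "c \<in> {commutator G x y | x y. x \<in> carrier G \<and> y \<in> carrier G}"
    then obtain x y where xy: "x \<in> carrier G" "y \<in> carrier G" and c: "c = commutator G x y"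
      by auto
    then have "c = inv x \<otimes> inv y \<otimes> inv (inv x) \<otimes> inv (inv y)" by (simp add: commutator_def)
    with xy show "c \<in> derived_set G (carrier G)"
      using inv_closed by blast
  qed
  then show ?thesis by (simp add: derived_def)
qed


section \<open>Normal closures\<close>

definition normal_closure :: "('a, 'm) monoid_scheme \<Rightarrow> 'a set \<Rightarrow> 'a set" where
  "normal_closure G S = \<Inter> {N. N \<lhd> G \<and> S \<subseteq> N}"

lemma (in group) normal_closure_normal:
  assumes "S \<subseteq> carrier G"
  shows "normal_closure G S \<lhd> G"
proof -
  let ?F = "{N. N \<lhd> G \<and> S \<subseteq> N}"
  have "carrier G \<lhd> G"
    by (rule normal_invI[OF subgroup_self]) auto
  with assms have ne: "?F \<noteq> {}" by blast
  show ?thesis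
    unfolding normal_closure_def
  proof (rule normal_invI)
    show "subgroup (\<Inter> ?F) G"
      by (rule subgroups_Inter) (use ne in \<open>auto intro: normal_imp_subgroup\<close>)
    fix x h assume "x \<in> carrier G" "h \<in> \<Inter> ?F"
    then show "x \<otimes> h \<otimes> inv x \<in> \<Inter> ?F"
      using normal.inv_op_closed2 by fastforce
  qed
qed

lemma normal_closure_superset: "S \<subseteq> normal_closure G S"
  by (auto simp: normal_closure_def)

lemma normal_closure_least: "\<lbrakk>N \<lhd> G; S \<subseteq> N\<rbrakk> \<Longrightarrow> normal_closure G S \<subseteq> N"
  by (auto simp: normal_closure_def)


section \<open>Free products\<close>

text \<open>The free product of \<open>G\<close> and \<open>H\<close> is the monoid of words over the disjoint union of the
  two carriers, modulo the least congruence that multiplies adjacent letters from the same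
  factor and deletes the two identity letters.\<close>

abbreviation fp_words ::
  "('a, 'm) monoid_scheme \<Rightarrow> ('b, 'n) monoid_scheme \<Rightarrow> ('a + 'b) list set" where
  "fp_words G H \<equiv> lists (Sum_Type.Plus (carrier G) (carrier H))"

inductive_set fp_cong ::
  "('a, 'm) monoid_scheme \<Rightarrow> ('b, 'n) monoid_scheme \<Rightarrow> (('a + 'b) list \<times> ('a + 'b) list) set"
  for G H where
    refl: "w \<in> fp_words G H \<Longrightarrow> (w, w) \<in> fp_cong G H"
  | sym: "(v, w) \<in> fp_cong G H \<Longrightarrow> (w, v) \<in> fp_cong G H"
  | trans: "\<lbrakk>(u, v) \<in> fp_cong G H; (v, w) \<in> fp_cong G H\<rbrakk> \<Longrightarrow> (u, w) \<in> fp_cong G H"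
  | append: "\<lbrakk>(u, v) \<in> fp_cong G H; (u', v') \<in> fp_cong G H\<rbrakk> \<Longrightarrow> (u @ u', v @ v') \<in> fp_cong G H"
  | mult_left: "\<lbrakk>x \<in> carrier G; y \<in> carrier G\<rbrakk> \<Longrightarrow>
      ([Inl x, Inl y], [Inl (x \<otimes>\<^bsub>G\<^esub> y)]) \<in> fp_cong G H"
  | mult_right: "\<lbrakk>x \<in> carrier H; y \<in> carrier H\<rbrakk> \<Longrightarrow>
      ([Inr x, Inr y], [Inr (x \<otimes>\<^bsub>H\<^esub> y)]) \<in> fp_cong G H"
  | one_left: "([Inl \<one>\<^bsub>G\<^esub>], []) \<in> fp_cong G H"
  | one_right: "([Inr \<one>\<^bsub>H\<^esub>], []) \<in> fp_cong G H"

definition free_product ::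
  "('a, 'm) monoid_scheme \<Rightarrow> ('b, 'n) monoid_scheme \<Rightarrow> ('a + 'b) list set monoid" where
  "free_product G H =
     \<lparr>carrier = fp_words G H // fp_cong G H,
      monoid.mult = (\<lambda>A B. \<Union>u\<in>A. \<Union>v\<in>B. fp_cong G H `` {u @ v}),
      one = fp_cong G H `` {[]}\<rparr>"

definition fp_inl ::
  "('a, 'm) monoid_scheme \<Rightarrow> ('b, 'n) monoid_scheme \<Rightarrow> 'a \<Rightarrow> ('a + 'b) list set" where
  "fp_inl G H x = fp_cong G H `` {[Inl x]}"

definition fp_inr ::
  "('a, 'm) monoid_scheme \<Rightarrow> ('b, 'n) monoid_scheme \<Rightarrow> 'b \<Rightarrow> ('a + 'b) list set" where
  "fp_inr G H y = fp_cong G H `` {[Inr y]}"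

context
  fixes G :: "('a, 'm) monoid_scheme" and H :: "('b, 'n) monoid_scheme"
  assumes G: "group G" and H: "group H"
begin

lemma fp_cong_words:
  "(v, w) \<in> fp_cong G H \<Longrightarrow>
     v \<in> fp_words G H \<and> w \<in> fp_words G H"
proof -
  interpret G: group G by (rule G)
  interpret H: group H by (rule H)
  show "(v, w) \<in> fp_cong G H \<Longrightarrow>
     v \<in> fp_words G H \<and> w \<in> fp_words G H"
    by (induction rule: fp_cong.induct) auto
qed

lemma equiv_fp_cong: "equiv (fp_words G H) (fp_cong G H)"
proof (rule equivI)
  show "fp_cong G H \<subseteq> fp_words G H \<times> fp_words G H"
    using fp_cong_words by auto
  show "refl_on (fp_words G H) (fp_cong G H)"
    by (auto simp: refl_on_def intro: fp_cong.refl)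
  show "sym (fp_cong G H)" by (auto intro: symI fp_cong.sym)
  show "trans (fp_cong G H)" by (auto intro: transI fp_cong.trans)
qed

lemma free_product_mult:
  assumes u: "u \<in> fp_words G H" and v: "v \<in> fp_words G H"
  shows "fp_cong G H `` {u} \<otimes>\<^bsub>free_product G H\<^esub> fp_cong G H `` {v} = fp_cong G H `` {u @ v}"
proof -
  have "congruent2 (fp_cong G H) (fp_cong G H) (\<lambda>u v. fp_cong G H `` {u @ v})"
  proof (rule congruent2I')
    fix y1 z1 y2 z2
    assume "(y1, z1) \<in> fp_cong G H" "(y2, z2) \<in> fp_cong G H"
    then show "fp_cong G H `` {y1 @ y2} = fp_cong G H `` {z1 @ z2}"
      by (intro equiv_class_eq[OF equiv_fp_cong] fp_cong.append)
  qed
  then show ?thesis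
    using UN_equiv_class2[OF equiv_fp_cong equiv_fp_cong _ u v] by (simp add: free_product_def)
qed

lemma free_product_carrierE:
  assumes "A \<in> carrier (free_product G H)"
  obtains w where "w \<in> fp_words G H" "A = fp_cong G H `` {w}"
  using assms by (auto simp: free_product_def quotient_def)

lemma free_product_carrierI:
  "w \<in> fp_words G H \<Longrightarrow> fp_cong G H `` {w} \<in> carrier (free_product G H)"
  by (simp add: free_product_def quotientI)

lemma free_product_one: "\<one>\<^bsub>free_product G H\<^esub> = fp_cong G H `` {[]}"
  by (simp add: free_product_def)

lemma fp_word_inverse:
  assumes "w \<in> fp_words G H"
  shows "\<exists>v \<in> fp_words G H. (v @ w, []) \<in> fp_cong G H"
  using assms
proof (induction w)
  case Nil
  then show ?case by (auto intro: fp_cong.refl)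
next
  case (Cons a w)
  interpret G: group G by (rule G)
  interpret H: group H by (rule H)
  obtain v where v: "v \<in> fp_words G H" "(v @ w, []) \<in> fp_cong G H"
    using Cons.IH by blast
  have "\<exists>b \<in> Sum_Type.Plus (carrier G) (carrier H). ([b, a], []) \<in> fp_cong G H"
  proof (cases a)
    case (Inl x)
    then have x: "x \<in> carrier G" using Cons.hyps by auto
    have "([Inl (inv\<^bsub>G\<^esub> x), Inl x], [Inl (inv\<^bsub>G\<^esub> x \<otimes>\<^bsub>G\<^esub> x)]) \<in> fp_cong G H"
      using x by (intro fp_cong.mult_left) auto
    with x have "([Inl (inv\<^bsub>G\<^esub> x), Inl x], []) \<in> fp_cong G H"
      using fp_cong.one_left fp_cong.trans by (metis G.l_inv)
    with x Inl show ?thesis by (intro bexI[of _ "Inl (inv\<^bsub>G\<^esub> x)"]) auto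
  next
    case (Inr x)
    then have x: "x \<in> carrier H" using Cons.hyps by auto
    have "([Inr (inv\<^bsub>H\<^esub> x), Inr x], [Inr (inv\<^bsub>H\<^esub> x \<otimes>\<^bsub>H\<^esub> x)]) \<in> fp_cong G H"
      using x by (intro fp_cong.mult_right) auto
    with x have "([Inr (inv\<^bsub>H\<^esub> x), Inr x], []) \<in> fp_cong G H"
      using fp_cong.one_right fp_cong.trans by (metis H.l_inv)
    with x Inr show ?thesis by (intro bexI[of _ "Inr (inv\<^bsub>H\<^esub> x)"]) auto
  qed
  then obtain b where b: "b \<in> Sum_Type.Plus (carrier G) (carrier H)" "([b, a], []) \<in> fp_cong G H" by blast
  have w: "w \<in> fp_words G H" using Cons.hyps by auto
  have "(v @ ([b, a] @ w), v @ ([] @ w)) \<in> fp_cong G H"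
    using v w b by (intro fp_cong.append fp_cong.refl) auto
  with v have "((v @ [b]) @ a # w, []) \<in> fp_cong G H"
    by (auto intro: fp_cong.trans)
  moreover have "v @ [b] \<in> fp_words G H" using v b by auto
  ultimately show ?case by blast
qed

lemma free_product_group: "group (free_product G H)"
proof (rule groupI)
  show "\<one>\<^bsub>free_product G H\<^esub> \<in> carrier (free_product G H)"
    by (simp add: free_product_one free_product_carrierI)
next
  fix x y assume "x \<in> carrier (free_product G H)" "y \<in> carrier (free_product G H)"
  then obtain u v where
    "u \<in> fp_words G H" "x = fp_cong G H `` {u}"
    "v \<in> fp_words G H" "y = fp_cong G H `` {v}"
    by (metis free_product_carrierE)
  then show "x \<otimes>\<^bsub>free_product G H\<^esub> y \<in> carrier (free_product G H)"
    by (simp add: free_product_mult free_product_carrierI)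
next
  fix x y z
  assume "x \<in> carrier (free_product G H)" "y \<in> carrier (free_product G H)"
    "z \<in> carrier (free_product G H)"
  then obtain u v w where
    "u \<in> fp_words G H" "x = fp_cong G H `` {u}"
    "v \<in> fp_words G H" "y = fp_cong G H `` {v}"
    "w \<in> fp_words G H" "z = fp_cong G H `` {w}"
    by (metis free_product_carrierE)
  then show "x \<otimes>\<^bsub>free_product G H\<^esub> y \<otimes>\<^bsub>free_product G H\<^esub> z =
      x \<otimes>\<^bsub>free_product G H\<^esub> (y \<otimes>\<^bsub>free_product G H\<^esub> z)"
    by (simp add: free_product_mult)
next
  fix x assume "x \<in> carrier (free_product G H)"
  then obtain u where u: "u \<in> fp_words G H" "x = fp_cong G H `` {u}"
    by (metis free_product_carrierE)
  then show "\<one>\<^bsub>free_product G H\<^esub> \<otimes>\<^bsub>free_product G H\<^esub> x = x"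
    using free_product_mult[of "[]" u] by (simp add: free_product_one)
  obtain v where v: "v \<in> fp_words G H" "(v @ u, []) \<in> fp_cong G H"
    using fp_word_inverse u by blast
  have "fp_cong G H `` {v} \<otimes>\<^bsub>free_product G H\<^esub> x = \<one>\<^bsub>free_product G H\<^esub>"
    using v u free_product_mult[of v u] equiv_class_eq[OF equiv_fp_cong v(2)]
    by (simp add: free_product_one)
  then show "\<exists>y\<in>carrier (free_product G H). y \<otimes>\<^bsub>free_product G H\<^esub> x = \<one>\<^bsub>free_product G H\<^esub>"
    using free_product_carrierI[OF v(1)] by (rule bexI)
qed

lemma fp_inl_hom: "fp_inl G H \<in> hom G (free_product G H)"
proof (rule homI)
  fix x assume "x \<in> carrier G"
  then show "fp_inl G H x \<in> carrier (free_product G H)"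
    unfolding fp_inl_def by (intro free_product_carrierI) auto
next
  fix x y assume xy: "x \<in> carrier G" "y \<in> carrier G"
  then show "fp_inl G H (x \<otimes>\<^bsub>G\<^esub> y) = fp_inl G H x \<otimes>\<^bsub>free_product G H\<^esub> fp_inl G H y"
    using free_product_mult[of "[Inl x]" "[Inl y]"]
      equiv_class_eq[OF equiv_fp_cong fp_cong.mult_left[OF xy]] xy
    by (simp add: InlI fp_inl_def)
qed

lemma fp_inr_hom: "fp_inr G H \<in> hom H (free_product G H)"
proof (rule homI)
  fix x assume "x \<in> carrier H"
  then show "fp_inr G H x \<in> carrier (free_product G H)"
    unfolding fp_inr_def by (intro free_product_carrierI) auto
next
  fix x y assume xy: "x \<in> carrier H" "y \<in> carrier H"
  then show "fp_inr G H (x \<otimes>\<^bsub>H\<^esub> y) = fp_inr G H x \<otimes>\<^bsub>free_product G H\<^esub> fp_inr G H y"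
    using free_product_mult[of "[Inr x]" "[Inr y]"]
      equiv_class_eq[OF equiv_fp_cong fp_cong.mult_right[OF xy]] xy
    by (simp add: InrI fp_inr_def)
qed

lemma free_product_generate:
  "carrier (free_product G H) =
     generate (free_product G H) (fp_inl G H ` carrier G \<union> fp_inr G H ` carrier H)"
    (is "_ = generate ?P ?S")
proof
  interpret P: group ?P by (rule free_product_group)
  have S: "?S \<subseteq> carrier ?P"
    using hom_carrier[OF fp_inl_hom] hom_carrier[OF fp_inr_hom] by (rule Un_least)
  show "generate ?P ?S \<subseteq> carrier ?P" using P.generate_incl[OF S] .
  have "fp_cong G H `` {w} \<in> generate ?P ?S" if "w \<in> fp_words G H" for w
    using that
  proof (induction w)
    case Nil
    then show ?case using generate.one[of ?P ?S] by (simp add: free_product_one)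
  next
    case (Cons a w)
    have "fp_cong G H `` {[a]} \<in> ?S"
      using Cons.hyps by (cases a) (auto simp: fp_inl_def fp_inr_def)
    then have "fp_cong G H `` {[a]} \<otimes>\<^bsub>?P\<^esub> fp_cong G H `` {w} \<in> generate ?P ?S"
      by (rule generate.eng[OF generate.incl Cons.IH])
    then show ?case
      using free_product_mult[of "[a]" w] Cons.hyps by simp
  qed
  then show "carrier ?P \<subseteq> generate ?P ?S"
    by (metis free_product_carrierE subsetI)
qed

lemma free_product_universal:
  assumes K: "group K" and f: "f \<in> hom G K" and g: "g \<in> hom H K"
  obtains h where "h \<in> hom (free_product G H) K"
    "\<And>x. x \<in> carrier G \<Longrightarrow> h (fp_inl G H x) = f x"
    "\<And>y. y \<in> carrier H \<Longrightarrow> h (fp_inr G H y) = g y"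
proof -
  interpret G: group G by (rule G)
  interpret H: group H by (rule H)
  interpret K: group K by (rule K)
  interpret f: group_hom G K f using f by unfold_locales
  interpret g: group_hom H K g using g by unfold_locales
  define ev where "ev = foldr (\<lambda>a. (\<otimes>\<^bsub>K\<^esub>) (case_sum f g a))"
  let ?e = "\<lambda>w. ev w \<one>\<^bsub>K\<^esub>"
  have closed: "?e w \<in> carrier K" if "w \<in> fp_words G H" for w
    using that unfolding ev_def by (induction w) auto
  have ev_append: "?e (v @ w) = ?e v \<otimes>\<^bsub>K\<^esub> ?e w"
    if "v \<in> fp_words G H" "w \<in> fp_words G H" for v w
    using that
  proof (induction v)
    case Nil
    then show ?case using closed by (simp add: ev_def)
  next
    case (Cons a v)
    have "case_sum f g a \<in> carrier K" using Cons.hyps by (cases a) auto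
    moreover have "?e (v @ w) = ?e v \<otimes>\<^bsub>K\<^esub> ?e w" using Cons by blast
    ultimately show ?case
      using closed[of v] closed[of w] Cons.hyps Cons.prems by (simp add: ev_def K.m_assoc)
  qed
  have resp: "?e v = ?e w" if "(v, w) \<in> fp_cong G H" for v w
    using that
  proof (induction rule: fp_cong.induct)
    case (append u v u' v')
    then show ?case using ev_append[of u u'] ev_append[of v v'] fp_cong_words by simp
  qed (auto simp: ev_def)
  define h where "h A = ?e (SOME w. w \<in> A)" for A
  have h: "h (fp_cong G H `` {w}) = ?e w" if "w \<in> fp_words G H" for w
  proof -
    have "w \<in> fp_cong G H `` {w}" using that by (auto intro: fp_cong.refl)
    then have "(SOME v. v \<in> fp_cong G H `` {w}) \<in> fp_cong G H `` {w}" by (rule someI)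
    then show ?thesis unfolding h_def using resp by fastforce
  qed
  show ?thesis
  proof
    show "h \<in> hom (free_product G H) K"
    proof (rule homI)
      fix x assume "x \<in> carrier (free_product G H)"
      then show "h x \<in> carrier K" using h closed by (metis free_product_carrierE)
    next
      fix x y assume "x \<in> carrier (free_product G H)" "y \<in> carrier (free_product G H)"
      then obtain u v where uv:
        "u \<in> fp_words G H" "x = fp_cong G H `` {u}"
        "v \<in> fp_words G H" "y = fp_cong G H `` {v}"
        by (metis free_product_carrierE)
      then show "h (x \<otimes>\<^bsub>free_product G H\<^esub> y) = h x \<otimes>\<^bsub>K\<^esub> h y"
        using h ev_append by (simp add: free_product_mult)
    qed
    show "h (fp_inl G H x) = f x" if "x \<in> carrier G" for x
      using h[of "[Inl x]"] that by (auto simp: fp_inl_def ev_def)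
    show "h (fp_inr G H y) = g y" if "y \<in> carrier H" for y
      using h[of "[Inr y]"] that by (auto simp: fp_inr_def ev_def)
  qed
qed

end


section \<open>The group \<open>\<nu>(G)\<close>\<close>

text \<open>Throughout, \<open>H\<close> is the copy $G^\varphi$ and \<open>\<phi>\<close> is the isomorphism from \<open>G\<close> to \<open>H\<close>.
  An equation $u = v$ is imposed through the relator $uv^{-1}$.\<close>

definition nu_relators ::
  "('a, 'm) monoid_scheme \<Rightarrow> ('b, 'n) monoid_scheme \<Rightarrow> ('a \<Rightarrow> 'b) \<Rightarrow> ('a + 'b) list set set" where
  "nu_relators G H \<phi> =
     (let P = free_product G H;
          i = fp_inl G H;
          j = (\<lambda>g. fp_inr G H (\<phi> g));
          mid = (\<lambda>g\<^sub>1 g\<^sub>2 g\<^sub>3. commutator P (i (conjugate G g\<^sub>1 g\<^sub>3)) (j (conjugate G g\<^sub>2 g\<^sub>3)))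
      in {conjugate P (commutator P (i g\<^sub>1) (j g\<^sub>2)) (i g\<^sub>3) \<otimes>\<^bsub>P\<^esub> inv\<^bsub>P\<^esub> (mid g\<^sub>1 g\<^sub>2 g\<^sub>3)
            | g\<^sub>1 g\<^sub>2 g\<^sub>3. g\<^sub>1 \<in> carrier G \<and> g\<^sub>2 \<in> carrier G \<and> g\<^sub>3 \<in> carrier G}
       \<union> {mid g\<^sub>1 g\<^sub>2 g\<^sub>3 \<otimes>\<^bsub>P\<^esub> inv\<^bsub>P\<^esub> (conjugate P (commutator P (i g\<^sub>1) (j g\<^sub>2)) (j g\<^sub>3))
            | g\<^sub>1 g\<^sub>2 g\<^sub>3. g\<^sub>1 \<in> carrier G \<and> g\<^sub>2 \<in> carrier G \<and> g\<^sub>3 \<in> carrier G})"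

definition nu ::
  "('a, 'm) monoid_scheme \<Rightarrow> ('b, 'n) monoid_scheme \<Rightarrow> ('a \<Rightarrow> 'b) \<Rightarrow> ('a + 'b) list set set monoid" where
  "nu G H \<phi> = free_product G H Mod normal_closure (free_product G H) (nu_relators G H \<phi>)"

text \<open>The images in \<open>\<nu>(G)\<close> of $g$ and of $g^\varphi$, for \<open>g\<close> in \<open>G\<close>.\<close>

definition nu_base ::
  "('a, 'm) monoid_scheme \<Rightarrow> ('b, 'n) monoid_scheme \<Rightarrow> ('a \<Rightarrow> 'b) \<Rightarrow> 'a \<Rightarrow> ('a + 'b) list set set" where
  "nu_base G H \<phi> g =
     normal_closure (free_product G H) (nu_relators G H \<phi>) #>\<^bsub>free_product G H\<^esub> fp_inl G H g"

definition nu_copy ::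
  "('a, 'm) monoid_scheme \<Rightarrow> ('b, 'n) monoid_scheme \<Rightarrow> ('a \<Rightarrow> 'b) \<Rightarrow> 'a \<Rightarrow> ('a + 'b) list set set" where
  "nu_copy G H \<phi> g =
     normal_closure (free_product G H) (nu_relators G H \<phi>) #>\<^bsub>free_product G H\<^esub> fp_inr G H (\<phi> g)"

definition tensors ::
  "('a, 'm) monoid_scheme \<Rightarrow> ('b, 'n) monoid_scheme \<Rightarrow> ('a \<Rightarrow> 'b) \<Rightarrow> ('a + 'b) list set set set" where
  "tensors G H \<phi> =
     {commutator (nu G H \<phi>) (nu_base G H \<phi> g) (nu_copy G H \<phi> h) | g h.
        g \<in> carrier G \<and> h \<in> carrier G}"

definition nonabelian_tensor_square ::
  "('a, 'm) monoid_scheme \<Rightarrow> ('b, 'n) monoid_scheme \<Rightarrow> ('a \<Rightarrow> 'b) \<Rightarrow> ('a + 'b) list set set set" where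
  "nonabelian_tensor_square G H \<phi> = generate (nu G H \<phi>) (tensors G H \<phi>)"

context
  fixes G :: "('a, 'm) monoid_scheme" and H :: "('b, 'n) monoid_scheme" and \<phi>
  assumes G: "group G" and H: "group H" and \<phi>: "\<phi> \<in> iso G H"
begin

lemma nu_relators_subset: "nu_relators G H \<phi> \<subseteq> carrier (free_product G H)"
proof -
  interpret G: group G by (rule G)
  interpret P: group "free_product G H" by (rule free_product_group[OF G H])
  have i: "fp_inl G H x \<in> carrier (free_product G H)" if "x \<in> carrier G" for x
    by (rule hom_in_carrier[OF fp_inl_hom[OF G H] that])
  have j: "fp_inr G H (\<phi> x) \<in> carrier (free_product G H)" if "x \<in> carrier G" for x
    by (rule hom_in_carrier[OF fp_inr_hom[OF G H] hom_in_carrier[OF iso_imp_homomorphism[OF \<phi>] that]])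
  show ?thesis
    unfolding nu_relators_def Let_def
    by (rule Un_least; rule subsetI; drule CollectD; elim exE conjE; hypsubst;
        (rule P.m_closed P.inv_closed P.conjugate_closed P.commutator_closed
          G.conjugate_closed i j | assumption)+)
qed

lemma nu_kernel_normal:
  "normal_closure (free_product G H) (nu_relators G H \<phi>) \<lhd> free_product G H"
  using group.normal_closure_normal[OF free_product_group[OF G H] nu_relators_subset] .

lemma nu_group: "group (nu G H \<phi>)"
  unfolding nu_def by (rule normal.factorgroup_is_group[OF nu_kernel_normal])

lemma nu_base_hom: "nu_base G H \<phi> \<in> hom G (nu G H \<phi>)"
proof -
  have "fp_inl G H \<in> hom G (free_product G H)"
    by (rule fp_inl_hom[OF G H])
  from hom_compose[OF this normal.r_coset_hom_Mod[OF nu_kernel_normal]] show ?thesis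
    unfolding nu_def nu_base_def[abs_def] comp_def .
qed

lemma nu_copy_hom: "nu_copy G H \<phi> \<in> hom G (nu G H \<phi>)"
proof -
  have "(\<lambda>g. fp_inr G H (\<phi> g)) \<in> hom G (free_product G H)"
    using hom_compose[of \<phi> G H, OF _ fp_inr_hom[OF G H]] \<phi> by (simp add: iso_def comp_def)
  from hom_compose[OF this normal.r_coset_hom_Mod[OF nu_kernel_normal]] show ?thesis
    unfolding nu_def nu_copy_def[abs_def] comp_def .
qed

end


section \<open>Abelianization and tensor products of abelian groups\<close>

definition abelianization :: "('a, 'm) monoid_scheme \<Rightarrow> 'a set monoid" where
  "abelianization G = G Mod derived G (carrier G)"

text \<open>The tensor product over the integers, as the free abelian group on pairs modulo
  biadditivity.\<close>

definition int_tensor_relators ::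
  "('a, 'm) monoid_scheme \<Rightarrow> ('b, 'n) monoid_scheme \<Rightarrow> ('a \<times> 'b \<Rightarrow>\<^sub>0 int) set" where
  "int_tensor_relators A B =
     {frag_of (a \<otimes>\<^bsub>A\<^esub> a', b) - frag_of (a, b) - frag_of (a', b) | a a' b.
        a \<in> carrier A \<and> a' \<in> carrier A \<and> b \<in> carrier B}
     \<union> {frag_of (a, b \<otimes>\<^bsub>B\<^esub> b') - frag_of (a, b) - frag_of (a, b') | a b b'.
        a \<in> carrier A \<and> b \<in> carrier B \<and> b' \<in> carrier B}"

definition int_tensor_product ::
  "('a, 'm) monoid_scheme \<Rightarrow> ('b, 'n) monoid_scheme \<Rightarrow> ('a \<times> 'b \<Rightarrow>\<^sub>0 int) set monoid" where
  "int_tensor_product A B =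
     free_Abelian_group (carrier A \<times> carrier B)
       Mod generate (free_Abelian_group (carrier A \<times> carrier B)) (int_tensor_relators A B)"

lemma int_tensor_relators_subset:
  fixes A :: "('a, 'm) monoid_scheme" and B :: "('c, 'n) monoid_scheme"
  assumes "group A" and "group B"
  shows "int_tensor_relators A B \<subseteq> carrier (free_Abelian_group (carrier A \<times> carrier B))"
proof -
  interpret A: group A by (rule assms)
  interpret B: group B by (rule assms)
  have diff: "frag_of p - frag_of q - frag_of r \<in> carrier (free_Abelian_group S)"
    if "p \<in> S" "q \<in> S" "r \<in> S" for S and p q r :: "'a \<times> 'c"
    using that keys_diff[of "frag_of p - frag_of q" "frag_of r"]
      keys_diff[of "frag_of p" "frag_of q"] by auto
  show ?thesis
    unfolding int_tensor_relators_def
    by (intro Un_least subsetI; drule CollectD; elim exE conjE; hypsubst; intro diff) auto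
qed

lemma int_tensor_product_comm_group:
  assumes "group A" and "group B"
  shows "comm_group (int_tensor_product A B)"
proof -
  interpret F: comm_group "free_Abelian_group (carrier A \<times> carrier B)"
    by (rule abelian_free_Abelian_group)
  show ?thesis
    unfolding int_tensor_product_def
    by (intro F.abelian_FactGroup F.generate_is_subgroup int_tensor_relators_subset assms)
qed

end

theory Submission
  imports Defs
begin

text \<open>Write \<open>N\<close> for the tensor square \<open>[G, G\<^sup>\<phi>]\<close> and \<open>T\<close> for the set of tensors.

  For every group, bounded conjugacy classes, finitely many commutators and a finite derived
  subgroup are the same thing.  That bounded classes leave only finitely many commutators is
  Neumann's argument with a class of maximal size (\<open>BFC_imp_finite_commutators\<close>).  That finitely many
  commutators generate a finite group rests on a variant of Dietzmann's lemma
  (\<open>finite_generate_if_shortenable\<close>): a finite set \<open>S\<close>, invariant under conjugation and inversion,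
  generates a finite group as soon as every \<open>s \<in> S\<close> has a power \<open>s\<^sup>m\<close> that is a product of fewer than \<open>m\<close> elements of \<open>S\<close>,
  since then long words can be shortened.  A commutator \<open>z = [a, b]\<close> has such a power: if the
  commutators \<open>[z\<^sup>n, b]\<close> are finite in number, some \<open>z\<^sup>n\<close> commutes with \<open>b\<close>, and then
  \<open>z\<^bsup>n+1\<^esup> = [a, b\<^sup>2] (z\<^sup>b)\<^bsup>n-1\<^esup>\<close>.

  The same argument works for tensors.  The defining relations imply \<open>[[x, h\<^sup>\<phi>], y\<^sup>\<phi>] = [[x, h], y\<^sup>\<phi>]\<close>
  (\<open>commutator_tensor\<close>), so that for \<open>t = [a, h\<^sup>\<phi>]\<close> the commutators \<open>[t\<^sup>n, h\<^sup>\<phi>] = [[a, h]\<^sup>n, h\<^sup>\<phi>]\<close> are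
  tensors again.  Hence if \<open>T\<close> is finite, so is \<open>N\<close>, and more generally, for \<open>A\<close> normal in \<open>G\<close>,
  finitely many tensors \<open>[a, h\<^sup>\<phi>]\<close> with \<open>a \<in> A\<close> generate a finite group.

  If \<open>T\<close> is finite, then so are its images under two homomorphisms from \<open>\<nu>(G)\<close>: the map onto \<open>G\<close> that
  forgets \<open>\<phi>\<close> sends \<open>T\<close> to the set of commutators of \<open>G\<close>, so \<open>G\<close> is a BFC-group; and a map to a
  Heisenberg group over \<open>G\<^sup>a\<^sup>b \<otimes> G\<^sup>a\<^sup>b\<close> sends \<open>T\<close> to the set of simple tensors, which therefore have finite
  order and generate a finite group.

  Conversely let \<open>G\<close> be a BFC-group with \<open>G\<^sup>a\<^sup>b \<otimes> G\<^sup>a\<^sup>b\<close> finite.  Then \<open>G'\<close> is finite, and for \<open>c = [x, y]\<close>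
  the tensor \<open>[c, h\<^sup>\<phi>] = [[x, y\<^sup>\<phi>], h\<^sup>\<phi>]\<close> depends only on the conjugates of \<open>x\<close> and \<open>y\<close> by \<open>h\<close>.  So there
  are finitely many tensors with an entry in \<open>G'\<close>, and they generate a finite normal subgroup.
  Modulo this subgroup tensors are central, biadditive and defined on \<open>G\<^sup>a\<^sup>b\<close>, so the image of \<open>N\<close> is a
  quotient of \<open>G\<^sup>a\<^sup>b \<otimes> G\<^sup>a\<^sup>b\<close> (\<open>finite_tensor_square_if_BFC\<close>).

  Finally, in \<open>\<nu>(G)/N\<close> the two copies of \<open>G\<close> commute, so modulo \<open>N\<close> every commutator of \<open>\<nu>(G)\<close> is of the
  form \<open>c d\<^sup>\<phi>\<close> with commutators \<open>c\<close>, \<open>d\<close> of \<open>G\<close>.  If \<open>N\<close> is finite there are finitely many of these.\<close>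

section \<open>Commutator calculus\<close>

lemma nat_function_repeats:
  assumes "finite (range (f :: nat \<Rightarrow> 'b))"
  obtains k l where "k < l" "f k = f l"
proof -
  have "\<not> inj f" using assms finite_imageD infinite_UNIV_nat by blast
  then obtain k l where "k \<noteq> l" "f k = f l" by (auto simp: inj_def)
  then show thesis using that by (metis linorder_neqE_nat)
qed

context group
begin

lemma inv_mult_cancel [simp]:
  "\<lbrakk>x \<in> carrier G; y \<in> carrier G\<rbrakk> \<Longrightarrow> inv x \<otimes> (x \<otimes> y) = y"
  "\<lbrakk>x \<in> carrier G; y \<in> carrier G\<rbrakk> \<Longrightarrow> x \<otimes> (inv x \<otimes> y) = y"
  by (simp_all flip: m_assoc)

lemma conjugate_mult:
  "\<lbrakk>x \<in> carrier G; y \<in> carrier G; z \<in> carrier G\<rbrakk> \<Longrightarrow>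
     conjugate G (x \<otimes> y) z = conjugate G x z \<otimes> conjugate G y z"
  by (simp add: conjugate_def m_assoc)

lemma conjugate_by_mult:
  "\<lbrakk>x \<in> carrier G; y \<in> carrier G; z \<in> carrier G\<rbrakk> \<Longrightarrow>
     conjugate G x (y \<otimes> z) = conjugate G (conjugate G x y) z"
  by (simp add: conjugate_def m_assoc inv_mult_group)

lemma conjugate_one [simp]:
  "x \<in> carrier G \<Longrightarrow> conjugate G x \<one> = x" "x \<in> carrier G \<Longrightarrow> conjugate G \<one> x = \<one>"
  by (simp_all add: conjugate_def)

lemma conjugate_inv:
  "\<lbrakk>x \<in> carrier G; y \<in> carrier G\<rbrakk> \<Longrightarrow> conjugate G (inv x) y = inv (conjugate G x y)"
  by (simp add: conjugate_def m_assoc inv_mult_group)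

lemma conjugate_conjugate_inv [simp]:
  assumes "x \<in> carrier G" "y \<in> carrier G"
  shows "conjugate G (conjugate G x (inv y)) y = x" "conjugate G (conjugate G x y) (inv y) = x"
  using assms by (simp_all add: conjugate_def m_assoc)

lemma conjugate_power:
  assumes "x \<in> carrier G" "y \<in> carrier G"
  shows "conjugate G (x [^] (n::nat)) y = conjugate G x y [^] n"
  by (induction n) (use assms in \<open>simp_all add: conjugate_mult\<close>)

lemma conjugate_eq_self_iff:
  assumes "x \<in> carrier G" "y \<in> carrier G"
  shows "conjugate G x y = x \<longleftrightarrow> x \<otimes> y = y \<otimes> x"
  using assms by (metis conjugate_def inv_solve_left m_assoc m_closed inv_closed)

lemma conjugate_eq_mult_commutator:
  "\<lbrakk>x \<in> carrier G; y \<in> carrier G\<rbrakk> \<Longrightarrow> conjugate G x y = x \<otimes> commutator G x y"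
  by (simp add: conjugate_def commutator_def m_assoc)

lemma commutator_eq_inv_mult_conjugate:
  "\<lbrakk>x \<in> carrier G; y \<in> carrier G\<rbrakk> \<Longrightarrow> commutator G x y = inv x \<otimes> conjugate G x y"
  by (simp add: conjugate_def commutator_def m_assoc)

lemma inv_commutator:
  "\<lbrakk>x \<in> carrier G; y \<in> carrier G\<rbrakk> \<Longrightarrow> inv (commutator G x y) = commutator G y x"
  by (simp add: commutator_def m_assoc inv_mult_group)

lemma commutator_one [simp]:
  "x \<in> carrier G \<Longrightarrow> commutator G x \<one> = \<one>" "x \<in> carrier G \<Longrightarrow> commutator G \<one> x = \<one>"
  by (simp_all add: commutator_def)

lemma commutator_eq_one_iff:
  "\<lbrakk>x \<in> carrier G; y \<in> carrier G\<rbrakk> \<Longrightarrow> commutator G x y = \<one> \<longleftrightarrow> x \<otimes> y = y \<otimes> x"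
  by (simp add: commutator_eq_inv_mult_conjugate inv_solve_left' flip: conjugate_eq_self_iff)

lemma commutator_mult_left:
  "\<lbrakk>x \<in> carrier G; y \<in> carrier G; z \<in> carrier G\<rbrakk> \<Longrightarrow>
     commutator G (x \<otimes> y) z = conjugate G (commutator G x z) y \<otimes> commutator G y z"
  by (simp add: conjugate_def commutator_def m_assoc inv_mult_group)

lemma commutator_mult_right:
  "\<lbrakk>x \<in> carrier G; y \<in> carrier G; z \<in> carrier G\<rbrakk> \<Longrightarrow>
     commutator G x (y \<otimes> z) = commutator G x z \<otimes> conjugate G (commutator G x y) z"
  by (simp add: conjugate_def commutator_def m_assoc inv_mult_group)

lemma conjugate_commutator:
  "\<lbrakk>x \<in> carrier G; y \<in> carrier G; z \<in> carrier G\<rbrakk> \<Longrightarrow>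
     conjugate G (commutator G x y) z = commutator G (conjugate G x z) (conjugate G y z)"
  by (simp add: conjugate_def commutator_def m_assoc inv_mult_group)

lemma inv_commutator_conjugate:
  "\<lbrakk>x \<in> carrier G; y \<in> carrier G\<rbrakk> \<Longrightarrow>
     inv (commutator G x y) = conjugate G (commutator G x (inv y)) y"
  by (simp add: conjugate_def commutator_def m_assoc inv_mult_group)

text \<open>If the set of commutators \<open>[z\<^sup>i, b]\<close> is finite, two of them agree, and
  \<open>[z\<^sup>i, b] = [z\<^sup>j, b]\<close> says that \<open>z\<^bsup>j - i\<^esup>\<close> commutes with \<open>b\<close>.\<close>

lemma power_commutes_if_finite_commutators:
  assumes z: "z \<in> carrier G" and b: "b \<in> carrier G"
    and fin: "finite (range (\<lambda>n::nat. commutator G (z [^] n) b))"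
  obtains n :: nat where "n > 0" "conjugate G (z [^] n) b = z [^] n"
proof -
  obtain k l :: nat where kl: "k < l" "commutator G (z [^] k) b = commutator G (z [^] l) b"
    using fin by (rule nat_function_repeats)
  define n where "n = l - k"
  have l: "z [^] l = z [^] n \<otimes> z [^] k" using kl z by (simp add: n_def nat_pow_mult)
  have "commutator G (z [^] l) b
      = conjugate G (commutator G (z [^] n) b) (z [^] k) \<otimes> commutator G (z [^] k) b"
    unfolding l using z b by (simp add: commutator_mult_left)
  with kl z b have "conjugate G (commutator G (z [^] n) b) (z [^] k) = \<one>"
    by (metis r_cancel_one commutator_closed conjugate_closed nat_pow_closed)
  then have "commutator G (z [^] n) b = \<one>"
    using z b by (metis conjugate_conjugate_inv(2) conjugate_one(2) commutator_closed
        nat_pow_closed inv_closed)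
  then have "conjugate G (z [^] n) b = z [^] n"
    using z b by (simp add: conjugate_eq_mult_commutator)
  moreover have "n > 0" using kl by (simp add: n_def)
  ultimately show thesis by (rule that[rotated])
qed

text \<open>The identity behind the classical proof of Schur's theorem.  If \<open>z\<^sup>n\<close> commutes with \<open>b\<close>,
  then \<open>z\<^bsup>n+1\<^esup> = z (z\<^sup>n)\<^sup>b = (z z\<^sup>b) (z\<^sup>b)\<^bsup>n-1\<^esup>\<close>, and the first two of these \<open>n + 1\<close> factors merge into the
  single commutator \<open>[a, b\<^sup>2]\<close>.\<close>

lemma commutator_power_shorter:
  assumes a: "a \<in> carrier G" and b: "b \<in> carrier G" and z: "z = commutator G a b"
    and n: "n > 0" and comm: "conjugate G (z [^] (n::nat)) b = z [^] n"
  shows "z [^] Suc n = commutator G a (b \<otimes> b) \<otimes> conjugate G z b [^] (n - 1)"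
proof -
  have zc: "z \<in> carrier G" using a b z by simp
  have "z [^] Suc n = z \<otimes> z [^] n" using zc by (simp only: nat_pow_Suc2)
  also have "\<dots> = z \<otimes> conjugate G z b [^] n" using comm zc b by (simp add: conjugate_power)
  also have "\<dots> = z \<otimes> (conjugate G z b \<otimes> conjugate G z b [^] (n - 1))"
    using n zc b by (metis Suc_diff_1 conjugate_closed nat_pow_Suc2)
  also have "\<dots> = commutator G a (b \<otimes> b) \<otimes> conjugate G z b [^] (n - 1)"
    using zc a b by (simp add: commutator_mult_right z m_assoc)
  finally show ?thesis .
qed

end

section \<open>A finiteness criterion for the subgroup generated by a finite set\<close>

definition word_prod :: "('a, 'm) monoid_scheme \<Rightarrow> 'a list \<Rightarrow> 'a" where
  "word_prod G ws = foldr (\<lambda>x y. x \<otimes>\<^bsub>G\<^esub> y) ws \<one>\<^bsub>G\<^esub>"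

text \<open>If \<open>s\<close> is shortenable, enough occurrences of the letter \<open>s\<close> in a row can be replaced by fewer
  letters.\<close>

definition shortenable :: "('a, 'm) monoid_scheme \<Rightarrow> 'a set \<Rightarrow> 'a \<Rightarrow> bool" where
  "shortenable G S s \<longleftrightarrow>
     (\<exists>m::nat. \<exists>ws \<in> lists S. length ws < m \<and> s [^]\<^bsub>G\<^esub> m = word_prod G ws)"

lemma shortenable_mono: "\<lbrakk>shortenable G S s; S \<subseteq> T\<rbrakk> \<Longrightarrow> shortenable G T s"
  unfolding shortenable_def using lists_mono by blast

context group
begin

lemma word_prod_simps [simp]:
  "word_prod G [] = \<one>" "word_prod G (x # ws) = x \<otimes> word_prod G ws"
  by (simp_all add: word_prod_def)

lemma word_prod_closed [simp]: "ws \<in> lists (carrier G) \<Longrightarrow> word_prod G ws \<in> carrier G"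
  by (induction ws) auto

lemma word_prod_append:
  "\<lbrakk>us \<in> lists (carrier G); vs \<in> lists (carrier G)\<rbrakk> \<Longrightarrow>
     word_prod G (us @ vs) = word_prod G us \<otimes> word_prod G vs"
  by (induction us) (auto simp: m_assoc)

lemma word_prod_replicate:
  "x \<in> carrier G \<Longrightarrow> word_prod G (replicate n x) = x [^] n"
  by (induction n) (simp_all only: replicate.simps word_prod_simps nat_pow_Suc2 nat_pow_0)

lemma generate_word_prod:
  assumes S: "S \<subseteq> carrier G" and inv: "\<And>s. s \<in> S \<Longrightarrow> inv s \<in> S"
    and x: "x \<in> generate G S"
  obtains ws where "ws \<in> lists S" "word_prod G ws = x"
proof -
  have "x \<in> word_prod G ` lists S" using x
  proof (induction rule: generate.induct)
    case one
    then show ?case by (intro image_eqI[of _ _ "[]"]) auto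
  next
    case (incl h)
    then show ?case using S by (intro image_eqI[of _ _ "[h]"]) auto
  next
    case (inv h)
    then show ?case using S assms(2) by (intro image_eqI[of _ _ "[inv h]"]) auto
  next
    case (eng h1 h2)
    then obtain us vs where "us \<in> lists S" "vs \<in> lists S"
      "h1 = word_prod G us" "h2 = word_prod G vs" by blast
    then show ?case using S lists_mono[OF S]
      by (intro image_eqI[of _ _ "us @ vs"]) (auto simp: word_prod_append subset_iff)
  qed
  then show thesis using that by blast
qed

lemma conjugate_power_mem:
  assumes "S \<subseteq> carrier G" "\<And>x y. \<lbrakk>x \<in> S; y \<in> S\<rbrakk> \<Longrightarrow> conjugate G x y \<in> S" "x \<in> S" "s \<in> S"
  shows "conjugate G x (s [^] (n::nat)) \<in> S"
proof (induction n)
  case 0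
  then show ?case using assms by auto
next
  case (Suc n)
  then show ?case using assms by (auto simp: conjugate_by_mult subset_iff)
qed

text \<open>Moving a letter \<open>s\<close> to the left past \<open>x\<close> replaces \<open>x\<close> by its conjugate, which is again a
  letter; so occurrences of \<open>s\<close> can be collected without lengthening the word.\<close>

lemma word_collect_letter:
  assumes S: "S \<subseteq> carrier G" and conj: "\<And>x y. \<lbrakk>x \<in> S; y \<in> S\<rbrakk> \<Longrightarrow> conjugate G x y \<in> S"
    and s: "s \<in> S"
  shows "ws \<in> lists S \<Longrightarrow> m \<le> count_list ws s \<Longrightarrow>
    \<exists>vs \<in> lists S. length vs + m = length ws \<and> word_prod G ws = s [^] m \<otimes> word_prod G vs"
proof (induction ws arbitrary: m)
  case Nil
  then show ?case by auto
next
  case (Cons x ws)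
  have sc: "s \<in> carrier G" and xc: "x \<in> carrier G" and wc: "ws \<in> lists (carrier G)"
    using s S Cons.prems by auto
  show ?case
  proof (cases "x = s \<and> m > 0")
    case True
    then obtain vs where vs: "vs \<in> lists S" "length vs + (m - 1) = length ws"
      "word_prod G ws = s [^] (m - 1) \<otimes> word_prod G vs"
      using Cons.IH[of "m - 1"] Cons.prems by (force simp: le_diff_conv)
    then have vc: "vs \<in> lists (carrier G)" using S by auto
    have "s [^] m = s \<otimes> s [^] (m - 1)"
      using True sc by (metis Suc_diff_1 nat_pow_Suc2)
    with True vs vc sc have "word_prod G (x # ws) = s [^] m \<otimes> word_prod G vs"
      by (simp add: m_assoc)
    with vs True show ?thesis by (intro bexI[of _ vs]) auto
  next
    case False
    then have "m \<le> count_list ws s" using Cons.prems by (auto split: if_splits)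
    then obtain vs where vs: "vs \<in> lists S" "length vs + m = length ws"
      "word_prod G ws = s [^] m \<otimes> word_prod G vs"
      using Cons.IH[of m] Cons.prems by auto
    then have vc: "vs \<in> lists (carrier G)" using S by auto
    have "conjugate G x (s [^] m) \<in> S"
      using conjugate_power_mem[OF S conj _ s, of x] Cons.prems by auto
    moreover have "word_prod G (x # ws) = s [^] m \<otimes> word_prod G (conjugate G x (s [^] m) # vs)"
      using vs vc sc xc by (simp add: conjugate_def m_assoc)
    ultimately show ?thesis using vs by (intro bexI[of _ "conjugate G x (s [^] m) # vs"]) auto
  qed
qed

text \<open>A variant of Dietzmann's lemma.  Let \<open>s\<^bsup>M s\<^esup>\<close> be a product of fewer than \<open>M s\<close> elements of \<open>S\<close>.
  In a word longer than \<open>\<Sum>s\<in>S. M s\<close> some letter \<open>s\<close> occurs at least \<open>M s\<close> times; these occurrences are collected and replaced by fewer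
  letters.  Hence words of bounded length represent all elements.  The usual hypothesis, that the
  elements of \<open>S\<close> have finite order, is the case where \<open>s\<^sup>m\<close> is the empty product.\<close>

lemma finite_generate_if_shortenable:
  assumes fin: "finite S" and S: "S \<subseteq> carrier G"
    and conj: "\<And>x y. \<lbrakk>x \<in> S; y \<in> S\<rbrakk> \<Longrightarrow> conjugate G x y \<in> S"
    and inv: "\<And>s. s \<in> S \<Longrightarrow> inv s \<in> S"
    and short: "\<And>s. s \<in> S \<Longrightarrow> shortenable G S s"
  shows "finite (generate G S)"
proof -
  obtain M :: "'a \<Rightarrow> nat" and W where MW: "\<And>s. s \<in> S \<Longrightarrow>
      W s \<in> lists S \<and> length (W s) < M s \<and> s [^] M s = word_prod G (W s)"
    using short unfolding shortenable_def by metis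
  define B where "B = sum M S"
  have bounded: "\<exists>vs \<in> lists S. length vs \<le> B \<and> word_prod G vs = word_prod G ws"
    if "ws \<in> lists S" for ws
    using that
  proof (induction "length ws" arbitrary: ws rule: less_induct)
    case less
    show ?case
    proof (cases "length ws \<le> B")
      case True
      then show ?thesis using less by auto
    next
      case False
      have "sum (count_list ws) S = length ws"
        using less.prems fin by (intro sum_count_set) auto
      then have "\<not> sum (count_list ws) S \<le> sum M S" using False B_def by simp
      then obtain s where s: "s \<in> S" "M s \<le> count_list ws s"
        by (meson nle_le sum_mono)
      obtain vs where vs: "vs \<in> lists S" "length vs + M s = length ws"
        "word_prod G ws = s [^] M s \<otimes> word_prod G vs"
        using word_collect_letter[OF S conj s(1) less.prems s(2)] by blast
      have W: "W s \<in> lists S" "length (W s) < M s" "s [^] M s = word_prod G (W s)"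
        using MW s by auto
      have "word_prod G (W s @ vs) = word_prod G ws"
        using W vs lists_mono[OF S] by (subst word_prod_append) auto
      moreover have "length (W s @ vs) < length ws" "W s @ vs \<in> lists S"
        using W vs by auto
      ultimately show ?thesis using less.hyps by metis
    qed
  qed
  have "generate G S \<subseteq> word_prod G ` {vs. set vs \<subseteq> S \<and> length vs \<le> B}"
  proof
    fix x assume "x \<in> generate G S"
    then obtain ws where "ws \<in> lists S" "word_prod G ws = x"
      using generate_word_prod[OF S inv] by blast
    then obtain vs where "vs \<in> lists S" "length vs \<le> B" "word_prod G vs = x"
      using bounded by blast
    then show "x \<in> word_prod G ` {vs. set vs \<subseteq> S \<and> length vs \<le> B}"
      by (intro image_eqI[of _ _ vs]) auto
  qed
  then show ?thesis
    using finite_lists_length_le[OF fin, of B] finite_surj by blast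
qed

text \<open>By \<open>commutator_power_shorter\<close>, \<open>z\<^bsup>n+1\<^esup>\<close> is then a word of \<open>n\<close> letters.\<close>

lemma commutator_shortenable:
  assumes "a \<in> carrier G" "b \<in> carrier G" and z: "z = commutator G a b"
    and fin: "finite (range (\<lambda>n::nat. commutator G (z [^] n) b))"
    and "commutator G a (b \<otimes> b) \<in> S" "conjugate G z b \<in> S"
  shows "shortenable G S z"
proof -
  have zc: "z \<in> carrier G" using assms by simp
  obtain n :: nat where n: "n > 0" "conjugate G (z [^] n) b = z [^] n"
    using power_commutes_if_finite_commutators[OF zc assms(2) fin] by blast
  let ?ws = "commutator G a (b \<otimes> b) # replicate (n - 1) (conjugate G z b)"
  have "z [^] Suc n = word_prod G ?ws"
    using commutator_power_shorter[OF assms(1,2) z n] zc assms(2)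
    by (simp add: word_prod_replicate)
  moreover have "?ws \<in> lists S" "length ?ws < Suc n" using assms n by auto
  ultimately show ?thesis unfolding shortenable_def by blast
qed

end

section \<open>Neumann's theorem on groups with bounded conjugacy classes\<close>

context group
begin

lemma conjugate_eq_iff_conjugate_inv:
  assumes "x \<in> carrier G" "g \<in> carrier G" "h \<in> carrier G"
  shows "conjugate G x g = conjugate G x h \<longleftrightarrow> conjugate G x (g \<otimes> inv h) = x"
  using assms by (metis conjugate_by_mult conjugate_conjugate_inv conjugate_closed inv_closed)

text \<open>The centralizer of a finite set has finite index when classes are finite: \<open>g\<close> and \<open>h\<close> lie in the
  same coset as soon as they conjugate each element of the set in the same way.\<close>

lemma finite_transversal_centralizer:
  assumes F: "finite F" "F \<subseteq> carrier G"
    and cls: "\<And>t. t \<in> F \<Longrightarrow> finite (conjugacy_class G t)"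
  obtains R where "finite R" "R \<subseteq> carrier G"
    "\<And>g. g \<in> carrier G \<Longrightarrow>
       \<exists>a\<in>carrier G. \<exists>r\<in>R. g = a \<otimes> r \<and> (\<forall>t\<in>F. conjugate G t a = t)"
proof -
  define \<theta> where "\<theta> g = restrict (\<lambda>t. conjugate G t g) F" for g
  have "\<theta> ` carrier G \<subseteq> (\<Pi>\<^sub>E t\<in>F. conjugacy_class G t)"
    by (auto simp: \<theta>_def conjugacy_class_def)
  moreover have "finite (\<Pi>\<^sub>E t\<in>F. conjugacy_class G t)"
    by (intro finite_PiE F cls)
  ultimately have "finite (\<theta> ` carrier G)" by (rule finite_subset)
  then obtain R where R: "R \<subseteq> carrier G" "finite R" "\<theta> ` carrier G = \<theta> ` R"
    using finite_subset_image[of "\<theta> ` carrier G" \<theta> "carrier G"] by blast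
  show thesis
  proof
    fix g assume g: "g \<in> carrier G"
    then obtain r where r: "r \<in> R" "\<theta> g = \<theta> r" using R(3) by blast
    have rc: "r \<in> carrier G" using r R by auto
    have "conjugate G t (g \<otimes> inv r) = t" if "t \<in> F" for t
    proof -
      have "conjugate G t g = conjugate G t r" using r(2) that by (metis \<theta>_def restrict_apply')
      then show ?thesis using conjugate_eq_iff_conjugate_inv that F g rc by blast
    qed
    moreover have "g = (g \<otimes> inv r) \<otimes> r" using g rc by (simp add: m_assoc)
    ultimately show "\<exists>a\<in>carrier G. \<exists>r\<in>R. g = a \<otimes> r \<and> (\<forall>t\<in>F. conjugate G t a = t)"
      using g rc r(1) by (intro bexI[of _ "g \<otimes> inv r"] bexI[of _ r]) auto
  qed (use R in auto)
qed

text \<open>Let \<open>x\<close> have a conjugacy class \<open>W\<close> of the largest size, and let \<open>a\<close> centralize elements that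
  conjugate \<open>x\<close> to each member of \<open>W\<close>.  Then \<open>a W\<close> lies in the class of \<open>a x\<close>, so it is all of
  that class by maximality.  Comparing \<open>(a x)\<^sup>g = a\<^sup>g x\<^sup>g\<close> with \<open>a w\<close> gives \<open>[a, g] = w (x\<^sup>g)\<^sup>-\<^sup>1\<close>, and this
  lies in the finite set \<open>W W\<^sup>-\<^sup>1\<close>.  The elements \<open>a\<close> form a subgroup of finite index, so
  \<open>commutator_mult_left\<close> bounds the number of all commutators.\<close>

theorem BFC_imp_finite_commutators:
  assumes "BFC_group G"
  shows "finite {commutator G x y | x y. x \<in> carrier G \<and> y \<in> carrier G}"
proof -
  obtain d where d: "\<And>x. x \<in> carrier G \<Longrightarrow>
      finite (conjugacy_class G x) \<and> card (conjugacy_class G x) \<le> d"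
    using assms unfolding BFC_group_def by blast
  have "\<exists>x. x \<in> carrier G \<and>
      (\<forall>y. y \<in> carrier G \<longrightarrow> card (conjugacy_class G y) \<le> card (conjugacy_class G x))"
    by (rule ex_has_greatest_nat[of _ \<one> _ "Suc d"]) (use d in \<open>auto simp: less_Suc_eq_le\<close>)
  then obtain x where x: "x \<in> carrier G"
    and max: "\<And>y. y \<in> carrier G \<Longrightarrow> card (conjugacy_class G y) \<le> card (conjugacy_class G x)"
    by blast
  define W where "W = conjugacy_class G x"
  have finW: "finite W" and Wc: "W \<subseteq> carrier G"
    using d x by (auto simp: W_def conjugacy_class_def)
  have "\<exists>t\<in>carrier G. conjugate G x t = w" if "w \<in> W" for w
    using that by (auto simp: W_def conjugacy_class_def)
  then obtain \<tau> where \<tau>: "\<And>w. w \<in> W \<Longrightarrow> \<tau> w \<in> carrier G \<and> conjugate G x (\<tau> w) = w"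
    by metis
  have \<tau>W: "\<tau> ` W \<subseteq> carrier G" using \<tau> by auto
  have clsW: "finite (conjugacy_class G t)" if "t \<in> \<tau> ` W" for t
    using that \<tau>W d by blast
  obtain R where R: "finite R" "R \<subseteq> carrier G"
    and dec: "\<And>g. g \<in> carrier G \<Longrightarrow>
       \<exists>a\<in>carrier G. \<exists>r\<in>R. g = a \<otimes> r \<and> (\<forall>t\<in>\<tau> ` W. conjugate G t a = t)"
    by (rule finite_transversal_centralizer[OF finite_imageI[OF finW] \<tau>W clsW]) blast+
  define D where "D = (\<lambda>(w, u). w \<otimes> inv u) ` (W \<times> W)"
  have finD: "finite D" unfolding D_def using finW by blast
  have small: "commutator G a g \<in> D"
    if a: "a \<in> carrier G" "\<forall>t\<in>\<tau> ` W. conjugate G t a = t" and g: "g \<in> carrier G" for a g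
  proof -
    have "(\<lambda>w. a \<otimes> w) ` W \<subseteq> conjugacy_class G (a \<otimes> x)"
    proof (rule image_subsetI)
      fix w assume w: "w \<in> W"
      have "a \<otimes> \<tau> w = \<tau> w \<otimes> a"
        using a w \<tau> conjugate_eq_self_iff[of "\<tau> w" a] by auto
      then have "conjugate G a (\<tau> w) = a" using conjugate_eq_self_iff a w \<tau> by blast
      then have "conjugate G (a \<otimes> x) (\<tau> w) = a \<otimes> w" using a x w \<tau> by (simp add: conjugate_mult)
      then show "a \<otimes> w \<in> conjugacy_class G (a \<otimes> x)"
        unfolding conjugacy_class_def using \<tau>[OF w] by (auto intro!: exI[of _ "\<tau> w"])
    qed
    moreover have "card ((\<lambda>w. a \<otimes> w) ` W) = card W"
      using inj_on_subset[OF inj_on_cmult[OF a(1)] Wc] by (rule card_image)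
    moreover have "card (conjugacy_class G (a \<otimes> x)) \<le> card W"
      unfolding W_def using a x by (intro max) auto
    ultimately have eq: "conjugacy_class G (a \<otimes> x) = (\<lambda>w. a \<otimes> w) ` W"
      using d[of "a \<otimes> x"] a x by (metis card_seteq m_closed)
    have "conjugate G (a \<otimes> x) g \<in> conjugacy_class G (a \<otimes> x)"
      unfolding conjugacy_class_def using g by blast
    then obtain w where w: "w \<in> W" "conjugate G (a \<otimes> x) g = a \<otimes> w" unfolding eq by blast
    have u: "conjugate G x g \<in> W" unfolding W_def conjugacy_class_def using g by blast
    have "conjugate G a g \<otimes> conjugate G x g = a \<otimes> w" using w a x g by (simp add: conjugate_mult)
    then have "conjugate G a g = a \<otimes> w \<otimes> inv (conjugate G x g)"
      using a x g w Wc by (metis conjugate_closed inv_solve_right m_closed subsetD)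
    then have "commutator G a g = w \<otimes> inv (conjugate G x g)"
      using a x g w Wc by (auto simp: commutator_eq_inv_mult_conjugate m_assoc)
    with w u show ?thesis unfolding D_def by (auto intro!: image_eqI[of _ _ "(w, conjugate G x g)"])
  qed
  have "{commutator G x y | x y. x \<in> carrier G \<and> y \<in> carrier G}
      \<subseteq> (\<Union>r\<in>R. (\<lambda>(c, v). conjugate G c r \<otimes> (inv r \<otimes> v)) ` (D \<times> conjugacy_class G r))"
  proof
    fix c assume "c \<in> {commutator G x y | x y. x \<in> carrier G \<and> y \<in> carrier G}"
    then obtain g h where gh: "g \<in> carrier G" "h \<in> carrier G" "c = commutator G g h" by blast
    obtain a r where ar: "a \<in> carrier G" "r \<in> R" "g = a \<otimes> r" "\<forall>t\<in>\<tau> ` W. conjugate G t a = t"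
      using dec[OF gh(1)] by blast
    have "c = conjugate G (commutator G a h) r \<otimes> (inv r \<otimes> conjugate G r h)"
      using gh ar R by (auto simp: commutator_mult_left commutator_eq_inv_mult_conjugate[of r h])
    moreover have "commutator G a h \<in> D" using small ar gh by blast
    moreover have "conjugate G r h \<in> conjugacy_class G r"
      unfolding conjugacy_class_def using gh by blast
    ultimately show "c \<in> (\<Union>r\<in>R. (\<lambda>(c, v). conjugate G c r \<otimes> (inv r \<otimes> v)) ` (D \<times> conjugacy_class G r))"
      by (intro UN_I[OF ar(2)] image_eqI[of _ _ "(commutator G a h, conjugate G r h)"]) simp_all
  qed
  moreover have "finite (\<Union>r\<in>R. (\<lambda>(c, v). conjugate G c r \<otimes> (inv r \<otimes> v)) ` (D \<times> conjugacy_class G r))"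
    by (intro finite_UN_I finite_imageI finite_cartesian_product R(1) finD) (meson d R(2) subsetD)
  ultimately show ?thesis by (rule finite_subset)
qed

lemma finite_commutators_imp_BFC:
  assumes "finite {commutator G x y | x y. x \<in> carrier G \<and> y \<in> carrier G}" (is "finite ?C")
  shows "BFC_group G"
proof -
  have sub: "conjugacy_class G x \<subseteq> (\<lambda>c. x \<otimes> c) ` ?C" if "x \<in> carrier G" for x
    using that unfolding conjugacy_class_def by (force simp: conjugate_eq_mult_commutator)
  \<comment> \<open>The successor makes the bound visibly positive.\<close>
  have "finite (conjugacy_class G x) \<and> card (conjugacy_class G x) \<le> Suc (card ?C)"
    if "x \<in> carrier G" for x
  proof
    show "finite (conjugacy_class G x)"
      using sub[OF that] finite_imageI[OF assms] by (rule finite_subset)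
    have "card (conjugacy_class G x) \<le> card ((\<lambda>c. x \<otimes> c) ` ?C)"
      using sub[OF that] finite_imageI[OF assms] by (intro card_mono)
    also have "\<dots> \<le> card ?C" by (rule card_image_le[OF assms])
    finally show "card (conjugacy_class G x) \<le> Suc (card ?C)" by simp
  qed
  then show ?thesis unfolding BFC_group_def using is_group by blast
qed

end

section \<open>Two copies of a group subject to the defining relations of \<open>\<nu>(G)\<close>\<close>

context group_hom
begin

lemma hom_conjugate:
  "\<lbrakk>x \<in> carrier G; y \<in> carrier G\<rbrakk> \<Longrightarrow> h (conjugate G x y) = conjugate H (h x) (h y)"
  by (simp add: conjugate_def)

lemma hom_commutator:
  "\<lbrakk>x \<in> carrier G; y \<in> carrier G\<rbrakk> \<Longrightarrow> h (commutator G x y) = commutator H (h x) (h y)"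
  by (simp add: commutator_def)

end

lemma (in group) generate_conjugate_closed:
  assumes Y: "Y \<subseteq> carrier G" and S: "S \<subseteq> carrier G"
    and inv: "\<And>x. x \<in> Y \<Longrightarrow> inv x \<in> Y"
    and conj: "\<And>s x. \<lbrakk>s \<in> S; x \<in> Y\<rbrakk> \<Longrightarrow> conjugate G s x \<in> S"
    and y: "y \<in> generate G Y"
  shows "s \<in> S \<Longrightarrow> conjugate G s y \<in> S"
  using y
proof (induction arbitrary: s rule: generate.induct)
  case one
  then show ?case using S by auto
next
  case (eng h1 h2)
  then have "conjugate G s (h1 \<otimes> h2) = conjugate G (conjugate G s h1) h2"
    using S Y generate_in_carrier by (intro conjugate_by_mult) auto
  then show ?case using eng by simp
qed (use conj inv in auto)

lemma (in group) normal_generate_if_conjugate_closed: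
  assumes S: "S \<subseteq> carrier G"
    and conj: "\<And>s x. \<lbrakk>s \<in> S; x \<in> carrier G\<rbrakk> \<Longrightarrow> conjugate G s x \<in> S"
  shows "generate G S \<lhd> G"
proof (rule normal_generateI[OF S])
  fix s x assume "s \<in> S" and x: "x \<in> carrier G"
  then have "conjugate G s (inv x) \<in> S" by (intro conj) auto
  then show "x \<otimes> s \<otimes> inv x \<in> S" using x by (simp add: conjugate_def)
qed

lemma (in normal) conjugate_mem:
  "\<lbrakk>a \<in> H; k \<in> carrier G\<rbrakk> \<Longrightarrow> conjugate G a k \<in> H"
  unfolding conjugate_def by (rule inv_op_closed1)

lemma (in normal) commutator_mem:
  "\<lbrakk>a \<in> H; k \<in> carrier G\<rbrakk> \<Longrightarrow> commutator G a k \<in> H"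
  using conjugate_mem[of a k] by (simp add: commutator_eq_inv_mult_conjugate)

text \<open>A group generated by the images of two homomorphisms \<open>i\<close> and \<open>j\<close> that satisfy the relations
  of \<open>\<nu>(G)\<close>.  The group \<open>\<nu>(G)\<close> and its quotients are of this kind, and so is \<open>G\<close> with \<open>i\<close> and \<open>j\<close> both the
  identity, where \<open>[g, h\<^sup>\<phi>]\<close> is the ordinary commutator.  The assumptions are symmetric in \<open>i\<close> and \<open>j\<close>,
  so every lemma has a dual.\<close>

locale tensor_pair = K: group K + G: group G
  for K :: "('k, 'n) monoid_scheme" and G :: "('a, 'm) monoid_scheme" (structure) +
  fixes i j :: "'a \<Rightarrow> 'k"
  assumes i_hom: "i \<in> hom G K" and j_hom: "j \<in> hom G K"
    and generated: "carrier K = generate K (i ` carrier G \<union> j ` carrier G)"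
    and conj_i: "\<lbrakk>g \<in> carrier G; h \<in> carrier G; k \<in> carrier G\<rbrakk> \<Longrightarrow>
      conjugate K (commutator K (i g) (j h)) (i k) =
      commutator K (i (conjugate G g k)) (j (conjugate G h k))"
    and conj_j: "\<lbrakk>g \<in> carrier G; h \<in> carrier G; k \<in> carrier G\<rbrakk> \<Longrightarrow>
      conjugate K (commutator K (i g) (j h)) (j k) =
      commutator K (i (conjugate G g k)) (j (conjugate G h k))"
begin

sublocale i: group_hom G K i by unfold_locales (rule i_hom)
sublocale j: group_hom G K j by unfold_locales (rule j_hom)

lemma swap: "tensor_pair K G j i"
proof
  show "carrier K = generate K (j ` carrier G \<union> i ` carrier G)"
    using generated by (simp add: Un_commute)
next
  fix g h k assume ghk: "g \<in> carrier G" "h \<in> carrier G" "k \<in> carrier G"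
  have eq: "commutator K (j x) (i y) = inv\<^bsub>K\<^esub> commutator K (i y) (j x)"
    if "x \<in> carrier G" "y \<in> carrier G" for x y
    using that by (simp add: K.inv_commutator)
  show "conjugate K (commutator K (j g) (i h)) (j k) =
      commutator K (j (conjugate G g k)) (i (conjugate G h k))"
    using ghk by (simp add: eq K.conjugate_inv conj_j)
  show "conjugate K (commutator K (j g) (i h)) (i k) =
      commutator K (j (conjugate G g k)) (i (conjugate G h k))"
    using ghk by (simp add: eq K.conjugate_inv conj_i)
qed (rule j_hom i_hom)+

abbreviation tensor :: "'a \<Rightarrow> 'a \<Rightarrow> 'k" where
  "tensor g h \<equiv> commutator K (i g) (j h)"

text \<open>By the defining relations, \<open>a\<close> and \<open>a\<^sup>\<phi>\<close> act in the same way on tensors, so \<open>[a, b\<^sup>\<phi>]\<close> acts like the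
  commutator \<open>[a, b]\<close> of \<open>G\<close>.\<close>

lemma conjugate_tensor_tensor:
  assumes "g \<in> carrier G" "h \<in> carrier G" "a \<in> carrier G" "b \<in> carrier G"
  shows "conjugate K (tensor g h) (tensor a b) = conjugate K (tensor g h) (i (commutator G a b))"
proof -
  have ab: "tensor a b = i (inv a) \<otimes>\<^bsub>K\<^esub> j (inv b) \<otimes>\<^bsub>K\<^esub> i a \<otimes>\<^bsub>K\<^esub> j b"
    using assms by (simp add: commutator_def)
  have "conjugate K (tensor g h) (tensor a b)
      = conjugate K (tensor g h) (i (inv a) \<otimes>\<^bsub>K\<^esub> j (inv b) \<otimes>\<^bsub>K\<^esub> i a \<otimes>\<^bsub>K\<^esub> j b)"
    by (simp only: ab)
  also have "\<dots> = tensor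
        (conjugate G (conjugate G (conjugate G (conjugate G g (inv a)) (inv b)) a) b)
        (conjugate G (conjugate G (conjugate G (conjugate G h (inv a)) (inv b)) a) b)"
    using assms by (simp add: K.conjugate_by_mult conj_i conj_j del: i.hom_inv j.hom_inv)
  also have "\<dots> = tensor (conjugate G g (commutator G a b)) (conjugate G h (commutator G a b))"
    using assms by (simp add: commutator_def G.conjugate_by_mult)
  also have "\<dots> = conjugate K (tensor g h) (i (commutator G a b))"
    using assms by (simp add: conj_i)
  finally show ?thesis .
qed

text \<open>Conjugating \<open>[x, u\<^sup>\<phi>]\<close> by \<open>h\<^sup>\<phi>\<close>, where \<open>y = u\<^sup>h\<close>, gives \<open>[x [x, h\<^sup>\<phi>], y\<^sup>\<phi>]\<close>, whereas by the
  defining relations it gives \<open>[x\<^sup>h, y\<^sup>\<phi>] = [x [x, h], y\<^sup>\<phi>]\<close>.  Expanding both and cancelling the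
  conjugates of \<open>[x, y\<^sup>\<phi>]\<close>, on which \<open>[x, h\<^sup>\<phi>]\<close> and \<open>[x, h]\<close> act alike, leaves \<open>[[x, h\<^sup>\<phi>], y\<^sup>\<phi>] = [[x, h], y\<^sup>\<phi>]\<close>.\<close>

lemma commutator_tensor:
  assumes x: "x \<in> carrier G" and h: "h \<in> carrier G" and y: "y \<in> carrier G"
  shows "commutator K (tensor x h) (j y) = tensor (commutator G x h) y"
proof -
  let ?y = "conjugate G y (inv h)"
  have xy: "tensor (conjugate G x h) y = conjugate K (tensor x ?y) (j h)"
    using x h y by (simp add: conj_j)
  also have "\<dots> = commutator K (conjugate K (i x) (j h)) (conjugate K (j ?y) (j h))"
    using x h y by (simp add: K.conjugate_commutator)
  also have "conjugate K (j ?y) (j h) = j y"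
    using x h y by (simp flip: j.hom_conjugate)
  also have "conjugate K (i x) (j h) = i x \<otimes>\<^bsub>K\<^esub> tensor x h"
    using x h by (simp add: K.conjugate_eq_mult_commutator)
  also have "commutator K (i x \<otimes>\<^bsub>K\<^esub> tensor x h) (j y)
      = conjugate K (tensor x y) (tensor x h) \<otimes>\<^bsub>K\<^esub> commutator K (tensor x h) (j y)"
    using x h y by (simp add: K.commutator_mult_left)
  finally have 1: "tensor (conjugate G x h) y
      = conjugate K (tensor x y) (tensor x h) \<otimes>\<^bsub>K\<^esub> commutator K (tensor x h) (j y)" .
  have "tensor (conjugate G x h) y
      = conjugate K (tensor x y) (i (commutator G x h)) \<otimes>\<^bsub>K\<^esub> tensor (commutator G x h) y"
    using x h y by (simp add: G.conjugate_eq_mult_commutator K.commutator_mult_left)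
  with 1 show ?thesis
    using x h y by (simp add: conjugate_tensor_tensor)
qed

lemma commutator_tensor_power:
  assumes x: "x \<in> carrier G" and h: "h \<in> carrier G" and y: "y \<in> carrier G"
  shows "commutator K (tensor x h [^]\<^bsub>K\<^esub> (n::nat)) (j y) = tensor (commutator G x h [^] n) y"
proof (induction n)
  case 0
  then show ?case using y by simp
next
  case (Suc n)
  have "commutator K (tensor x h [^]\<^bsub>K\<^esub> Suc n) (j y)
     = conjugate K (tensor (commutator G x h [^] n) y) (tensor x h) \<otimes>\<^bsub>K\<^esub>
       tensor (commutator G x h) y"
    using x h y Suc by (simp add: K.commutator_mult_left commutator_tensor)
  also have "\<dots> = tensor (commutator G x h [^] Suc n) y"
    using x h y by (simp add: K.commutator_mult_left conjugate_tensor_tensor)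
  finally show ?case .
qed

abbreviation tensors_of :: "'a set \<Rightarrow> 'k set" where
  "tensors_of A \<equiv> {tensor a h | a h. a \<in> A \<and> h \<in> carrier G}"

lemma conjugate_closed_if_generators:
  assumes "S \<subseteq> carrier K"
    and "\<And>s k. \<lbrakk>s \<in> S; k \<in> carrier G\<rbrakk> \<Longrightarrow> conjugate K s (i k) \<in> S \<and> conjugate K s (j k) \<in> S"
    and "s \<in> S" "x \<in> carrier K"
  shows "conjugate K s x \<in> S"
proof (rule K.generate_conjugate_closed[OF _ assms(1) _ _ _ assms(3)])
  show "i ` carrier G \<union> j ` carrier G \<subseteq> carrier K" by auto
  show "inv\<^bsub>K\<^esub> x \<in> i ` carrier G \<union> j ` carrier G" if "x \<in> i ` carrier G \<union> j ` carrier G" for x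
    using that by (force simp flip: i.hom_inv j.hom_inv)
  show "x \<in> generate K (i ` carrier G \<union> j ` carrier G)" using assms(4) generated by simp
qed (use assms(2) in auto)

lemma tensors_of_subset: "A \<subseteq> carrier G \<Longrightarrow> tensors_of A \<subseteq> carrier K"
  by auto

lemma conjugate_tensors_of:
  assumes A: "A \<lhd> G" and s: "s \<in> tensors_of A" and x: "x \<in> carrier K"
  shows "conjugate K s x \<in> tensors_of A"
proof (rule conjugate_closed_if_generators[OF _ _ s x])
  have Ac: "A \<subseteq> carrier G" using A normal_imp_subgroup subgroup.subset by blast
  then show "tensors_of A \<subseteq> carrier K" by (rule tensors_of_subset)
  fix s k assume "s \<in> tensors_of A" and k: "k \<in> carrier G"
  then obtain a h where s: "a \<in> A" "h \<in> carrier G" "s = tensor a h" by blast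
  then have "conjugate K s (i k) = tensor (conjugate G a k) (conjugate G h k)"
    "conjugate K s (j k) = tensor (conjugate G a k) (conjugate G h k)"
    using Ac k by (auto simp: conj_i conj_j)
  moreover have "tensor (conjugate G a k) (conjugate G h k) \<in> tensors_of A"
    using normal.conjugate_mem[OF A s(1) k] s(2) k G.conjugate_closed by blast
  ultimately show "conjugate K s (i k) \<in> tensors_of A \<and> conjugate K s (j k) \<in> tensors_of A"
    by simp
qed

lemma inv_tensors_of:
  assumes A: "A \<lhd> G" and s: "s \<in> tensors_of A"
  shows "inv\<^bsub>K\<^esub> s \<in> tensors_of A"
proof -
  obtain a h where ah: "a \<in> A" "h \<in> carrier G" "s = tensor a h" using s by blast
  then have ac: "a \<in> carrier G" using A normal_imp_subgroup subgroup.subset by blast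
  have "inv\<^bsub>K\<^esub> s = conjugate K (tensor a (inv h)) (j h)"
    using ah ac by (simp add: K.inv_commutator_conjugate)
  moreover have "tensor a (inv h) \<in> tensors_of A" using ah by blast
  ultimately show ?thesis using conjugate_tensors_of[OF A] ah by simp
qed

text \<open>For \<open>t = [a, h\<^sup>\<phi>]\<close> the commutators \<open>[t\<^sup>n, h\<^sup>\<phi>] = [[a, h]\<^sup>n, h\<^sup>\<phi>]\<close> again have their left entry in
  \<open>A\<close>, so there are only finitely many.\<close>

lemma tensors_of_shortenable:
  assumes A: "A \<lhd> G" and fin: "finite (tensors_of A)" and s: "s \<in> tensors_of A"
  shows "shortenable K (tensors_of A) s"
proof -
  interpret A: subgroup A G using A by (rule normal_imp_subgroup)
  obtain a h where ah: "a \<in> A" "h \<in> carrier G" "s = tensor a h" using s by blast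
  have "commutator G a h [^] n \<in> A" for n :: nat
    using normal.commutator_mem[OF A ah(1,2)] by (induction n) auto
  then have "range (\<lambda>n::nat. commutator K (s [^]\<^bsub>K\<^esub> n) (j h)) \<subseteq> tensors_of A"
    using ah by (auto simp: commutator_tensor_power)
  then have fin': "finite (range (\<lambda>n::nat. commutator K (s [^]\<^bsub>K\<^esub> n) (j h)))"
    using fin by (rule finite_subset)
  have "commutator K (i a) (j h \<otimes>\<^bsub>K\<^esub> j h) = tensor a (h \<otimes> h)" using ah by simp
  then have "commutator K (i a) (j h \<otimes>\<^bsub>K\<^esub> j h) \<in> tensors_of A"
    using ah by blast
  then show ?thesis
    using ah conjugate_tensors_of[OF A s] by (intro K.commutator_shortenable[OF _ _ ah(3) fin']) auto
qed

theorem finite_generate_tensors: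
  assumes "finite (tensors_of (carrier G))"
  shows "finite (generate K (tensors_of (carrier G)))"
proof (rule K.finite_generate_if_shortenable[OF assms])
  note N = G.normal_self
  show "tensors_of (carrier G) \<subseteq> carrier K" by (rule tensors_of_subset) simp
  then show "conjugate K x y \<in> tensors_of (carrier G)"
    if "x \<in> tensors_of (carrier G)" "y \<in> tensors_of (carrier G)" for x y
    using conjugate_tensors_of[OF N that(1)] that(2) by blast
  show "inv\<^bsub>K\<^esub> s \<in> tensors_of (carrier G)" "shortenable K (tensors_of (carrier G)) s"
    if "s \<in> tensors_of (carrier G)" for s
    using inv_tensors_of[OF N that] tensors_of_shortenable[OF N assms that] .
qed

end

text \<open>For the identity pair, the tensors are the commutators of \<open>G\<close> and they generate \<open>G'\<close>.\<close>

lemma (in group) tensor_pair_id: "tensor_pair G G (\<lambda>x. x) (\<lambda>x. x)"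
proof
  show "carrier G = generate G ((\<lambda>x. x) ` carrier G \<union> (\<lambda>x. x) ` carrier G)"
    using generate_incl[of "carrier G"] by (auto intro: generate.incl)
qed (auto simp: hom_def conjugate_commutator)

lemma (in group) finite_commutators_imp_finite_derived:
  assumes "finite {commutator G x y | x y. x \<in> carrier G \<and> y \<in> carrier G}"
  shows "finite (derived G (carrier G))"
  using tensor_pair.finite_generate_tensors[OF tensor_pair_id] assms
  by (simp add: derived_eq_generate_commutators)

lemma (in group) commutator_in_derived:
  "\<lbrakk>x \<in> carrier G; y \<in> carrier G\<rbrakk> \<Longrightarrow> commutator G x y \<in> derived G (carrier G)"
  unfolding derived_eq_generate_commutators by (rule generate.incl) blast

lemma (in group) finite_derived_imp_finite_commutators:
  assumes "finite (derived G (carrier G))"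
  shows "finite {commutator G x y | x y. x \<in> carrier G \<and> y \<in> carrier G}"
  by (rule finite_subset[OF _ assms]) (auto intro: commutator_in_derived)

section \<open>Tensor products of abelian groups\<close>

definition simple_tensor ::
  "('a, 'm) monoid_scheme \<Rightarrow> ('b, 'n) monoid_scheme \<Rightarrow> 'a \<Rightarrow> 'b \<Rightarrow> ('a \<times> 'b \<Rightarrow>\<^sub>0 int) set" where
  "simple_tensor A B a b =
     generate (free_Abelian_group (carrier A \<times> carrier B)) (int_tensor_relators A B)
       #>\<^bsub>free_Abelian_group (carrier A \<times> carrier B)\<^esub> frag_of (a, b)"

context
  fixes A :: "('a, 'm) monoid_scheme" and B :: "('b, 'n) monoid_scheme"
  assumes A: "group A" and B: "group B"
begin

private abbreviation (input) "F \<equiv> free_Abelian_group (carrier A \<times> carrier B)"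
private abbreviation (input) "R \<equiv> generate F (int_tensor_relators A B)"

lemma relators_normal: "R \<lhd> F"
proof -
  interpret F: comm_group F by (rule abelian_free_Abelian_group)
  show ?thesis
    using F.generate_is_subgroup[OF int_tensor_relators_subset[OF A B]]
    by (simp add: F.normal_iff_subgroup)
qed

lemma quotient_hom: "(\<lambda>x. R #>\<^bsub>F\<^esub> x) \<in> hom F (int_tensor_product A B)"
  unfolding int_tensor_product_def by (rule normal.r_coset_hom_Mod[OF relators_normal])

lemma simple_tensor_closed:
  "\<lbrakk>a \<in> carrier A; b \<in> carrier B\<rbrakk> \<Longrightarrow> simple_tensor A B a b \<in> carrier (int_tensor_product A B)"
  unfolding simple_tensor_def by (intro hom_in_carrier[OF quotient_hom]) simp

lemma simple_tensor_eqI: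
  assumes "x \<in> carrier A \<times> carrier B" "y \<in> carrier A \<times> carrier B" "z \<in> carrier A \<times> carrier B"
    and rel: "frag_of x - frag_of y - frag_of z \<in> int_tensor_relators A B"
  shows "R #>\<^bsub>F\<^esub> frag_of x =
    (R #>\<^bsub>F\<^esub> frag_of y) \<otimes>\<^bsub>int_tensor_product A B\<^esub> (R #>\<^bsub>F\<^esub> frag_of z)"
proof -
  interpret F: comm_group F by (rule abelian_free_Abelian_group)
  have sub: "subgroup R F" using relators_normal by (rule normal_imp_subgroup)
  have c: "frag_of x \<in> carrier F" "frag_of y \<in> carrier F" "frag_of z \<in> carrier F"
    using assms by (metis frag_of_in_free_Abelian_group)+
  have c': "frag_of y \<otimes>\<^bsub>F\<^esub> frag_of z \<in> carrier F" using c by (intro F.m_closed)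
  have "frag_of x \<otimes>\<^bsub>F\<^esub> inv\<^bsub>F\<^esub> (frag_of y \<otimes>\<^bsub>F\<^esub> frag_of z)
      = frag_of x - frag_of y - frag_of z"
    using c' by (simp add: diff_diff_eq)
  also have "\<dots> \<in> R" using rel by (rule generate.incl)
  finally have "R #>\<^bsub>F\<^esub> frag_of x = R #>\<^bsub>F\<^esub> (frag_of y \<otimes>\<^bsub>F\<^esub> frag_of z)"
    by (metis F.repr_independence c(1) c' sub subgroup.rcos_module_rev[OF sub F.is_group])
  also have "\<dots> = (R #>\<^bsub>F\<^esub> frag_of y) \<otimes>\<^bsub>int_tensor_product A B\<^esub> (R #>\<^bsub>F\<^esub> frag_of z)"
    by (rule hom_mult[OF quotient_hom c(2,3)])
  finally show ?thesis .
qed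

lemma simple_tensor_mult_left:
  assumes "a \<in> carrier A" "a' \<in> carrier A" "b \<in> carrier B"
  shows "simple_tensor A B (a \<otimes>\<^bsub>A\<^esub> a') b =
    simple_tensor A B a b \<otimes>\<^bsub>int_tensor_product A B\<^esub> simple_tensor A B a' b"
proof -
  interpret A: group A by (rule A)
  show ?thesis
    unfolding simple_tensor_def
    by (rule simple_tensor_eqI) (use assms in \<open>auto simp: int_tensor_relators_def\<close>)
qed

lemma simple_tensor_mult_right:
  assumes "a \<in> carrier A" "b \<in> carrier B" "b' \<in> carrier B"
  shows "simple_tensor A B a (b \<otimes>\<^bsub>B\<^esub> b') =
    simple_tensor A B a b \<otimes>\<^bsub>int_tensor_product A B\<^esub> simple_tensor A B a b'"
proof -
  interpret B: group B by (rule B)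
  show ?thesis
    unfolding simple_tensor_def
    by (rule simple_tensor_eqI) (use assms in \<open>auto simp: int_tensor_relators_def\<close>)
qed

lemma int_tensor_product_generate:
  "carrier (int_tensor_product A B) = generate (int_tensor_product A B)
     {simple_tensor A B a b | a b. a \<in> carrier A \<and> b \<in> carrier B}" (is "_ = generate ?P ?S")
proof
  interpret P: comm_group ?P by (rule int_tensor_product_comm_group[OF A B])
  interpret q: group_hom F ?P "\<lambda>x. R #>\<^bsub>F\<^esub> x"
    by (intro group_hom.intro group_hom_axioms.intro P.is_group quotient_hom) simp
  have S: "?S \<subseteq> carrier ?P" using simple_tensor_closed by auto
  then show "generate ?P ?S \<subseteq> carrier ?P" by (rule P.generate_incl)
  interpret S: subgroup "generate ?P ?S" ?P by (rule P.generate_is_subgroup[OF S])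
  have "R #>\<^bsub>F\<^esub> x \<in> generate ?P ?S" if "x \<in> carrier F" for x
  proof (rule free_Abelian_group_induct[of x "carrier A \<times> carrier B"])
    show "R #>\<^bsub>F\<^esub> 0 \<in> generate ?P ?S" using q.hom_one by simp
  next
    fix y z :: "'a \<times> 'b \<Rightarrow>\<^sub>0 int"
    assume yz: "Poly_Mapping.keys y \<subseteq> carrier A \<times> carrier B"
      "Poly_Mapping.keys z \<subseteq> carrier A \<times> carrier B"
      "R #>\<^bsub>F\<^esub> y \<in> generate ?P ?S" "R #>\<^bsub>F\<^esub> z \<in> generate ?P ?S"
    then have "y \<in> carrier F" "z \<in> carrier F" by simp_all
    then have "R #>\<^bsub>F\<^esub> (y \<otimes>\<^bsub>F\<^esub> inv\<^bsub>F\<^esub> z) = (R #>\<^bsub>F\<^esub> y) \<otimes>\<^bsub>?P\<^esub> inv\<^bsub>?P\<^esub> (R #>\<^bsub>F\<^esub> z)"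
      by (simp only: q.hom_mult q.hom_inv q.G.inv_closed)
    then show "R #>\<^bsub>F\<^esub> (y - z) \<in> generate ?P ?S" using yz by simp
  next
    fix p assume "p \<in> carrier A \<times> carrier B"
    then show "R #>\<^bsub>F\<^esub> frag_of p \<in> generate ?P ?S"
      by (cases p) (auto intro!: generate.incl simp: simple_tensor_def)
  qed (use that in simp)
  then show "carrier ?P \<subseteq> generate ?P ?S"
    unfolding int_tensor_product_def by (auto simp: FactGroup_def RCOSETS_def)
qed

lemma int_tensor_product_universal:
  assumes C: "comm_group C"
    and f: "\<And>a b. \<lbrakk>a \<in> carrier A; b \<in> carrier B\<rbrakk> \<Longrightarrow> f a b \<in> carrier C"
    and left: "\<And>a a' b. \<lbrakk>a \<in> carrier A; a' \<in> carrier A; b \<in> carrier B\<rbrakk> \<Longrightarrow>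
        f (a \<otimes>\<^bsub>A\<^esub> a') b = f a b \<otimes>\<^bsub>C\<^esub> f a' b"
    and right: "\<And>a b b'. \<lbrakk>a \<in> carrier A; b \<in> carrier B; b' \<in> carrier B\<rbrakk> \<Longrightarrow>
        f a (b \<otimes>\<^bsub>B\<^esub> b') = f a b \<otimes>\<^bsub>C\<^esub> f a b'"
  obtains h where "h \<in> hom (int_tensor_product A B) C"
    "\<And>a b. \<lbrakk>a \<in> carrier A; b \<in> carrier B\<rbrakk> \<Longrightarrow> h (simple_tensor A B a b) = f a b"
proof -
  interpret A: group A by (rule A)
  interpret B: group B by (rule B)
  interpret C: comm_group C by (rule C)
  have "case_prod f ` (carrier A \<times> carrier B) \<subseteq> carrier C" using f by auto
  then obtain h where h: "h \<in> hom F C"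
    and hf: "\<And>p. p \<in> carrier A \<times> carrier B \<Longrightarrow> h (frag_of p) = case_prod f p"
    using C.free_Abelian_group_universal by blast
  interpret h: group_hom F C h
    by (intro group_hom.intro group_hom_axioms.intro C.is_group h) simp
  have "h r = \<one>\<^bsub>C\<^esub>" if r: "r \<in> int_tensor_relators A B" for r
  proof -
    have *: "h (frag_of p - frag_of q - frag_of q') = \<one>\<^bsub>C\<^esub>"
      if "p \<in> carrier A \<times> carrier B" "q \<in> carrier A \<times> carrier B" "q' \<in> carrier A \<times> carrier B"
        and eq: "case_prod f p = case_prod f q \<otimes>\<^bsub>C\<^esub> case_prod f q'" for p q q'
    proof -
      have c: "frag_of p \<in> carrier F" "frag_of q \<in> carrier F" "frag_of q' \<in> carrier F"
        using that by (metis frag_of_in_free_Abelian_group)+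
      have "frag_of p - frag_of q - frag_of q'
          = frag_of p \<otimes>\<^bsub>F\<^esub> inv\<^bsub>F\<^esub> (frag_of q \<otimes>\<^bsub>F\<^esub> frag_of q')"
        using h.G.m_closed[OF c(2,3)] by (simp add: diff_diff_eq)
      also have "h \<dots> = h (frag_of p) \<otimes>\<^bsub>C\<^esub> inv\<^bsub>C\<^esub> (h (frag_of q) \<otimes>\<^bsub>C\<^esub> h (frag_of q'))"
        using c by (simp only: h.hom_mult h.hom_inv h.G.m_closed h.G.inv_closed)
      also have "\<dots> = \<one>\<^bsub>C\<^esub>"
        using that(1-3) h.hom_closed[OF c(1)] by (simp add: hf eq[symmetric])
      finally show ?thesis .
    qed
    from r show ?thesis
      unfolding int_tensor_relators_def using left right by (auto intro!: *)
  qed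
  then have "int_tensor_relators A B \<subseteq> kernel F C h"
    using int_tensor_relators_subset[OF A B] by (auto simp: kernel_def subset_iff)
  then have "R \<subseteq> kernel F C h"
    by (rule h.G.generate_subgroup_incl[OF _ h.subgroup_kernel])
  then obtain k where k: "k \<in> hom (F Mod R) C" "\<And>x. x \<in> carrier F \<Longrightarrow> k (R #>\<^bsub>F\<^esub> x) = h x"
    using h.FactGroup_universal_kernel[OF relators_normal] by blast
  show thesis
  proof
    show "k \<in> hom (int_tensor_product A B) C" using k(1) by (simp add: int_tensor_product_def)
    show "k (simple_tensor A B a b) = f a b" if "a \<in> carrier A" "b \<in> carrier B" for a b
      unfolding simple_tensor_def using that by (subst k(2)) (auto simp: hf)
  qed
qed

text \<open>The powers of \<open>a \<otimes> b\<close> are the simple tensors \<open>a\<^sup>n \<otimes> b\<close>.  If these are finite in number, every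
  generator has finite order.\<close>

lemma finite_int_tensor_product:
  assumes fin: "finite {simple_tensor A B a b | a b. a \<in> carrier A \<and> b \<in> carrier B}"
    (is "finite ?S")
  shows "finite (carrier (int_tensor_product A B))" (is "finite (carrier ?P)")
proof -
  interpret A: group A by (rule A)
  interpret B: group B by (rule B)
  interpret P: comm_group ?P by (rule int_tensor_product_comm_group[OF A B])
  have S: "?S \<subseteq> carrier ?P" using simple_tensor_closed by auto
  have "finite (generate ?P ?S)"
  proof (rule P.finite_generate_if_shortenable[OF fin S])
    fix x y assume "x \<in> ?S" "y \<in> ?S"
    then have "x \<in> carrier ?P" "y \<in> carrier ?P" using S by auto
    then have "conjugate ?P x y = x" by (simp add: P.conjugate_eq_self_iff P.m_comm)
    then show "conjugate ?P x y \<in> ?S" using \<open>x \<in> ?S\<close> by simp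
  next
    fix s assume s: "s \<in> ?S"
    then obtain a b where ab: "a \<in> carrier A" "b \<in> carrier B" "s = simple_tensor A B a b"
      by blast
    have hom: "(\<lambda>x. simple_tensor A B x b) \<in> hom A ?P"
      using ab by (auto simp: hom_def simple_tensor_closed simple_tensor_mult_left)
    interpret t: group_hom A ?P "\<lambda>x. simple_tensor A B x b"
      by (intro group_hom.intro group_hom_axioms.intro A P.is_group hom)
    have "inv\<^bsub>?P\<^esub> s = simple_tensor A B (inv\<^bsub>A\<^esub> a) b"
      using ab t.hom_inv by simp
    then show "inv\<^bsub>?P\<^esub> s \<in> ?S"
      using ab by blast
    have pow: "s [^]\<^bsub>?P\<^esub> (n::nat) = simple_tensor A B (a [^]\<^bsub>A\<^esub> n) b" for n
      using ab t.hom_nat_pow by simp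
    have "range (\<lambda>n::nat. s [^]\<^bsub>?P\<^esub> n) \<subseteq> ?S"
      unfolding pow using ab by blast
    then have "finite (range (\<lambda>n::nat. s [^]\<^bsub>?P\<^esub> n))"
      using fin by (rule finite_subset)
    then obtain k l :: nat where kl: "k < l" "s [^]\<^bsub>?P\<^esub> k = s [^]\<^bsub>?P\<^esub> l"
      by (rule nat_function_repeats)
    have sc: "s \<in> carrier ?P" using s S by blast
    have "s [^]\<^bsub>?P\<^esub> (l - k) \<otimes>\<^bsub>?P\<^esub> s [^]\<^bsub>?P\<^esub> k = s [^]\<^bsub>?P\<^esub> l"
      using kl(1) sc by (simp add: P.nat_pow_mult)
    then have "s [^]\<^bsub>?P\<^esub> (l - k) = word_prod ?P []"
      using sc kl(2) by (metis P.r_cancel_one P.nat_pow_closed P.word_prod_simps(1))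
    moreover have "length [] < l - k" using kl by simp
    ultimately show "shortenable ?P ?S s"
      unfolding shortenable_def by blast
  qed
  then show ?thesis using int_tensor_product_generate by simp
qed

end

section \<open>From finiteness of \<open>G\<^sup>a\<^sup>b \<otimes> G\<^sup>a\<^sup>b\<close> to finiteness of the tensor square\<close>

text \<open>If \<open>c = [x, y]\<close> then \<open>[c, h\<^sup>\<phi>] = [t, h\<^sup>\<phi>] = t\<^sup>-\<^sup>1 t\<^sup>h\<close> for \<open>t = [x, y\<^sup>\<phi>]\<close>, and the
  conjugate \<open>t\<^sup>h = [x\<^sup>h, (y\<^sup>h)\<^sup>\<phi>]\<close> depends only on the conjugates \<open>x\<^sup>h\<close> and \<open>y\<^sup>h\<close>, which take
  finitely many values.  The identity \<open>[c d, h\<^sup>\<phi>] = [c, h\<^sup>\<phi>]\<^sup>d [d, h\<^sup>\<phi>]\<close> carries this over to products.\<close>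

lemma (in tensor_pair) finite_tensors_of_derived_element:
  assumes cls: "\<And>x. x \<in> carrier G \<Longrightarrow> finite (conjugacy_class G x)"
    and c: "c \<in> derived G (carrier G)"
  shows "finite ((\<lambda>h. tensor c h) ` carrier G)"
proof -
  have comm: "finite ((\<lambda>h. tensor (commutator G x y) h) ` carrier G)"
    if xy: "x \<in> carrier G" "y \<in> carrier G" for x y
  proof (rule finite_subset)
    show "(\<lambda>h. tensor (commutator G x y) h) ` carrier G \<subseteq>
        (\<lambda>(u, v). inv\<^bsub>K\<^esub> tensor x y \<otimes>\<^bsub>K\<^esub> tensor u v) `
          (conjugacy_class G x \<times> conjugacy_class G y)"
    proof (rule image_subsetI)
      fix h assume h: "h \<in> carrier G"
      have "tensor (commutator G x y) h = commutator K (tensor x y) (j h)"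
        using xy h by (simp add: commutator_tensor)
      also have "\<dots> = inv\<^bsub>K\<^esub> tensor x y \<otimes>\<^bsub>K\<^esub> tensor (conjugate G x h) (conjugate G y h)"
        using xy h by (simp add: K.commutator_eq_inv_mult_conjugate[of "tensor x y" "j h"] conj_j)
      finally show "tensor (commutator G x y) h \<in>
        (\<lambda>(u, v). inv\<^bsub>K\<^esub> tensor x y \<otimes>\<^bsub>K\<^esub> tensor u v) `
          (conjugacy_class G x \<times> conjugacy_class G y)"
        using h unfolding conjugacy_class_def
        by (intro image_eqI[of _ _ "(conjugate G x h, conjugate G y h)"]) auto
    qed
    show "finite ((\<lambda>(u, v). inv\<^bsub>K\<^esub> tensor x y \<otimes>\<^bsub>K\<^esub> tensor u v) `
          (conjugacy_class G x \<times> conjugacy_class G y))"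
      using xy cls by (intro finite_imageI finite_cartesian_product) auto
  qed
  let ?C = "{commutator G x y | x y. x \<in> carrier G \<and> y \<in> carrier G}"
  have "c \<in> generate G ?C" using c by (simp add: G.derived_eq_generate_commutators)
  then show ?thesis
  proof (induction rule: generate.induct)
    case one
    then show ?case by (rule finite_subset[of _ "{\<one>\<^bsub>K\<^esub>}", rotated]) auto
  next
    case (incl c)
    then show ?case using comm by blast
  next
    case (inv c)
    then obtain x y where "x \<in> carrier G" "y \<in> carrier G" "inv c = commutator G y x"
      using G.inv_commutator by auto
    then show ?case using comm by simp
  next
    case (eng c d)
    have "?C \<subseteq> carrier G" by auto
    then have cd: "c \<in> carrier G" "d \<in> carrier G"
      using eng.hyps G.generate_in_carrier by blast+
    have "(\<lambda>h. tensor (c \<otimes> d) h) ` carrier G \<subseteq>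
        (\<lambda>(u, v). conjugate K u (i d) \<otimes>\<^bsub>K\<^esub> v) `
          ((\<lambda>h. tensor c h) ` carrier G \<times> (\<lambda>h. tensor d h) ` carrier G)"
    proof (rule image_subsetI)
      fix h assume h: "h \<in> carrier G"
      then have "tensor (c \<otimes> d) h = conjugate K (tensor c h) (i d) \<otimes>\<^bsub>K\<^esub> tensor d h"
        using cd by (simp add: K.commutator_mult_left)
      then show "tensor (c \<otimes> d) h \<in> (\<lambda>(u, v). conjugate K u (i d) \<otimes>\<^bsub>K\<^esub> v) `
          ((\<lambda>h. tensor c h) ` carrier G \<times> (\<lambda>h. tensor d h) ` carrier G)"
        using h by (intro image_eqI[of _ _ "(tensor c h, tensor d h)"]) auto
    qed
    then show ?case
      by (rule finite_subset) (intro finite_imageI finite_cartesian_product eng.IH)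
  qed
qed

lemma (in tensor_pair) finite_tensors_of_derived:
  assumes BFC: "BFC_group G"
  shows "finite (tensors_of (derived G (carrier G)))"
proof -
  have cls: "finite (conjugacy_class G x)" if "x \<in> carrier G" for x
    using BFC that unfolding BFC_group_def by blast
  have "finite (derived G (carrier G))"
    using G.BFC_imp_finite_commutators[OF BFC] by (rule G.finite_commutators_imp_finite_derived)
  then have "finite (\<Union>c\<in>derived G (carrier G). (\<lambda>h. tensor c h) ` carrier G)"
    using finite_tensors_of_derived_element[OF cls] by (intro finite_UN_I)
  then show ?thesis by (rule finite_subset[rotated]) auto
qed

text \<open>Shortenability is inherited by larger sets, so the two finite sets \<open>[G', G\<^sup>\<phi>]\<close> and
  \<open>[G'\<^sup>\<phi>, G]\<close> of generators can be treated together.\<close>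

lemma (in tensor_pair) finite_generate_tensors_derived:
  fixes S
  defines "S \<equiv> tensors_of (derived G (carrier G)) \<union>
    {commutator K (j c) (i h) | c h. c \<in> derived G (carrier G) \<and> h \<in> carrier G}"
  assumes BFC: "BFC_group G"
  shows "generate K S \<lhd> K" and "finite (generate K S)"
proof -
  interpret swap: tensor_pair K G j i by (rule swap)
  note D = G.derived_self_is_normal
  have Dc: "derived G (carrier G) \<subseteq> carrier G" by (rule G.derived_in_carrier) simp
  have Sc: "S \<subseteq> carrier K"
    unfolding S_def using tensors_of_subset[OF Dc] swap.tensors_of_subset[OF Dc] by (rule Un_least)
  have fin: "finite S"
    unfolding S_def using finite_tensors_of_derived[OF BFC] swap.finite_tensors_of_derived[OF BFC]
    by (rule finite_UnI)
  have conj: "conjugate K s x \<in> S" if "s \<in> S" "x \<in> carrier K" for s x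
    using that conjugate_tensors_of[OF D _ that(2)] swap.conjugate_tensors_of[OF D _ that(2)]
    unfolding S_def by blast
  show "generate K S \<lhd> K"
    using Sc conj by (rule K.normal_generate_if_conjugate_closed)
  show "finite (generate K S)"
  proof (rule K.finite_generate_if_shortenable[OF fin Sc])
    show "conjugate K x y \<in> S" if "x \<in> S" "y \<in> S" for x y using conj that Sc by blast
    show "inv\<^bsub>K\<^esub> s \<in> S" if "s \<in> S" for s
      using that inv_tensors_of[OF D] swap.inv_tensors_of[OF D] unfolding S_def by blast
    show "shortenable K S s" if "s \<in> S" for s
      using that tensors_of_shortenable[OF D finite_tensors_of_derived[OF BFC]]
        swap.tensors_of_shortenable[OF D swap.finite_tensors_of_derived[OF BFC]]
      unfolding S_def by (meson Un_iff Un_upper1 Un_upper2 shortenable_mono)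
  qed
qed

lemma (in tensor_pair) hom_image_tensor_pair:
  assumes Q: "group Q" and p: "p \<in> hom K Q" and surj: "p ` carrier K = carrier Q"
  shows "tensor_pair Q G (\<lambda>g. p (i g)) (\<lambda>g. p (j g))"
proof -
  interpret Q: group Q by (rule Q)
  interpret p: group_hom K Q p using p by unfold_locales
  show ?thesis
  proof
    show "(\<lambda>g. p (i g)) \<in> hom G Q" "(\<lambda>g. p (j g)) \<in> hom G Q" by (auto simp: hom_def)
    have "carrier Q = p ` generate K (i ` carrier G \<union> j ` carrier G)"
      using surj generated by simp
    also have "\<dots> = generate Q (p ` (i ` carrier G \<union> j ` carrier G))"
      by (rule p.generate_img[symmetric]) auto
    finally show "carrier Q =
        generate Q ((\<lambda>g. p (i g)) ` carrier G \<union> (\<lambda>g. p (j g)) ` carrier G)"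
      by (simp add: image_Un image_image)
    fix g h k assume ghk: "g \<in> carrier G" "h \<in> carrier G" "k \<in> carrier G"
    show "conjugate Q (commutator Q (p (i g)) (p (j h))) (p (i k)) =
        commutator Q (p (i (conjugate G g k))) (p (j (conjugate G h k)))"
      using ghk conj_i[OF ghk] by (simp flip: p.hom_conjugate p.hom_commutator)
    show "conjugate Q (commutator Q (p (i g)) (p (j h))) (p (j k)) =
        commutator Q (p (i (conjugate G g k))) (p (j (conjugate G h k)))"
      using ghk conj_j[OF ghk] by (simp flip: p.hom_conjugate p.hom_commutator)
  qed
qed

text \<open>When \<open>G'\<close> commutes with \<open>G\<^sup>\<phi>\<close> and \<open>G'\<^sup>\<phi>\<close> with \<open>G\<close>, the tensor \<open>[g, h\<^sup>\<phi>]\<close> depends only on the classes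
  of \<open>g\<close> and \<open>h\<close> modulo \<open>G'\<close>.  Conjugation does not change these classes, so tensors are central, and
  then biadditive.\<close>

locale derived_central_tensor_pair = tensor_pair +
  assumes left_trivial: "\<lbrakk>c \<in> derived G (carrier G); h \<in> carrier G\<rbrakk> \<Longrightarrow> tensor c h = \<one>\<^bsub>K\<^esub>"
    and right_trivial: "\<lbrakk>g \<in> carrier G; c \<in> derived G (carrier G)\<rbrakk> \<Longrightarrow> tensor g c = \<one>\<^bsub>K\<^esub>"
begin

lemma derived_subset: "derived G (carrier G) \<subseteq> carrier G"
  by (rule G.derived_in_carrier) simp

lemma tensor_mult_derived:
  assumes "c \<in> derived G (carrier G)" "g \<in> carrier G" "h \<in> carrier G"
  shows "tensor (c \<otimes> g) h = tensor g h" "tensor g (c \<otimes> h) = tensor g h"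
proof -
  have c: "c \<in> carrier G" using assms derived_subset by blast
  show "tensor (c \<otimes> g) h = tensor g h" "tensor g (c \<otimes> h) = tensor g h"
    using assms c by (simp_all add: K.commutator_mult_left K.commutator_mult_right
        left_trivial right_trivial)
qed

lemma tensor_central:
  assumes g: "g \<in> carrier G" and h: "h \<in> carrier G" and x: "x \<in> carrier K"
  shows "conjugate K (tensor g h) x = tensor g h"
proof -
  have conj: "conjugate G y k = commutator G k (inv y) \<otimes> y"
    if "y \<in> carrier G" "k \<in> carrier G" for y k
    using that by (simp add: conjugate_def commutator_def G.m_assoc)
  have *: "tensor (conjugate G g k) (conjugate G h k) = tensor g h" if "k \<in> carrier G" for k
    using g h that by (simp add: conj tensor_mult_derived G.commutator_in_derived del: i.hom_mult j.hom_mult)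
  have "conjugate K (tensor g h) x \<in> {tensor g h}"
    by (rule conjugate_closed_if_generators[OF _ _ _ x]) (use g h in \<open>auto simp: conj_i conj_j *\<close>)
  then show ?thesis by simp
qed

lemma tensor_mult_left:
  "\<lbrakk>g \<in> carrier G; g' \<in> carrier G; h \<in> carrier G\<rbrakk> \<Longrightarrow>
     tensor (g \<otimes> g') h = tensor g h \<otimes>\<^bsub>K\<^esub> tensor g' h"
  by (simp add: K.commutator_mult_left tensor_central)

lemma tensor_commute:
  assumes "g \<in> carrier G" "h \<in> carrier G" "x \<in> carrier K"
  shows "tensor g h \<otimes>\<^bsub>K\<^esub> x = x \<otimes>\<^bsub>K\<^esub> tensor g h"
  using tensor_central[OF assms] assms by (simp add: K.conjugate_eq_self_iff)

lemma tensor_mult_right: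
  "\<lbrakk>g \<in> carrier G; h \<in> carrier G; h' \<in> carrier G\<rbrakk> \<Longrightarrow>
     tensor g (h \<otimes> h') = tensor g h \<otimes>\<^bsub>K\<^esub> tensor g h'"
  by (simp add: K.commutator_mult_right tensor_central tensor_commute[of g h "tensor g h'"])

lemma comm_group_tensors: "comm_group (K\<lparr>carrier := generate K (tensors_of (carrier G))\<rparr>)"
proof -
  let ?T = "tensors_of (carrier G)"
  have T: "?T \<subseteq> carrier K" by (rule tensors_of_subset) simp
  have central: "x \<otimes>\<^bsub>K\<^esub> y = y \<otimes>\<^bsub>K\<^esub> x" if "x \<in> generate K ?T" and y: "y \<in> carrier K" for x y
    using that(1)
  proof (induction rule: generate.induct)
    case one
    then show ?case using y by simp
  next
    case (incl t)
    then show ?case using y tensor_commute by blast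
  next
    case (inv t)
    then have "inv\<^bsub>K\<^esub> t \<in> ?T" by (rule inv_tensors_of[OF G.normal_self])
    then obtain g h where "g \<in> carrier G" "h \<in> carrier G" "inv\<^bsub>K\<^esub> t = tensor g h" by auto
    then show ?case using tensor_commute[OF _ _ y] by simp
  next
    case (eng s t)
    then have "s \<in> carrier K" "t \<in> carrier K" using K.generate_in_carrier[OF T] by auto
    then show ?case using eng y by (metis K.m_assoc)
  qed
  have "group (K\<lparr>carrier := generate K ?T\<rparr>)"
    by (rule K.subgroup_imp_group[OF K.generate_is_subgroup[OF T]])
  then show ?thesis
    by (rule group.group_comm_groupI)
      (use central K.generate_in_carrier[OF T] in auto)
qed

text \<open>By the universal property, the tensor square is a quotient of \<open>G\<^sup>a\<^sup>b \<otimes> G\<^sup>a\<^sup>b\<close>.\<close>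

lemma finite_generate_tensors_if_finite_tensor_product:
  assumes fin: "finite (carrier (int_tensor_product (abelianization G) (abelianization G)))"
  shows "finite (generate K (tensors_of (carrier G)))"
proof -
  let ?A = "abelianization G" and ?D = "derived G (carrier G)"
  let ?T = "tensors_of (carrier G)"
  let ?L = "K\<lparr>carrier := generate K ?T\<rparr>"
  interpret L: comm_group ?L by (rule comm_group_tensors)
  interpret D: normal ?D G by (rule G.derived_self_is_normal)
  have A: "group ?A" unfolding abelianization_def by (rule G.derived_quot_is_group)
  have Ac: "carrier ?A = (\<lambda>g. ?D #> g) ` carrier G"
    unfolding abelianization_def by (auto simp: FactGroup_def RCOSETS_def)
  have Amult: "(?D #> g) \<otimes>\<^bsub>?A\<^esub> (?D #> h) = ?D #> (g \<otimes> h)"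
    if "g \<in> carrier G" "h \<in> carrier G" for g h
    using that D.rcos_sum by (simp add: abelianization_def)
  \<comment> \<open>The choice of representatives does not matter, by \<open>tensor_mult_derived\<close>.\<close>
  define f where "f = (\<lambda>U V. tensor (SOME g. g \<in> U) (SOME h. h \<in> V))"
  have rep: "\<exists>c\<in>?D. (SOME x. x \<in> ?D #> g) = c \<otimes> g" if "g \<in> carrier G" for g
  proof -
    have "(SOME x. x \<in> ?D #> g) \<in> ?D #> g"
      using G.rcos_self[OF that D.subgroup_axioms] by (rule someI)
    then show ?thesis by (auto simp: r_coset_def)
  qed
  have f: "f (?D #> g) (?D #> h) = tensor g h" if "g \<in> carrier G" "h \<in> carrier G" for g h
  proof -
    from rep[OF that(1)] rep[OF that(2)] obtain c d where cd: "c \<in> ?D" "(SOME x. x \<in> ?D #> g) = c \<otimes> g"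
      "d \<in> ?D" "(SOME x. x \<in> ?D #> h) = d \<otimes> h"
      by blast
    have "d \<otimes> h \<in> carrier G" using cd derived_subset that by auto
    then show ?thesis using cd that by (simp add: f_def tensor_mult_derived del: i.hom_mult j.hom_mult)
  qed
  have inT: "tensor g h \<in> generate K ?T" if "g \<in> carrier G" "h \<in> carrier G" for g h
    using that by (intro generate.incl) blast
  obtain k where k: "k \<in> hom (int_tensor_product ?A ?A) ?L"
    and kf: "\<And>U V. \<lbrakk>U \<in> carrier ?A; V \<in> carrier ?A\<rbrakk> \<Longrightarrow> k (simple_tensor ?A ?A U V) = f U V"
  proof (rule int_tensor_product_universal[OF A A L.comm_group_axioms, of f])
    show "f U V \<in> carrier ?L" if "U \<in> carrier ?A" "V \<in> carrier ?A" for U V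
      using that inT unfolding Ac by (auto simp: f)
    show "f (U \<otimes>\<^bsub>?A\<^esub> U') V = f U V \<otimes>\<^bsub>?L\<^esub> f U' V"
      if "U \<in> carrier ?A" "U' \<in> carrier ?A" "V \<in> carrier ?A" for U U' V
      using that unfolding Ac by (auto simp: Amult f tensor_mult_left simp del: i.hom_mult)
    show "f U (V \<otimes>\<^bsub>?A\<^esub> V') = f U V \<otimes>\<^bsub>?L\<^esub> f U V'"
      if "U \<in> carrier ?A" "V \<in> carrier ?A" "V' \<in> carrier ?A" for U V V'
      using that unfolding Ac by (auto simp: Amult f tensor_mult_right simp del: j.hom_mult)
  qed blast
  interpret P: comm_group "int_tensor_product ?A ?A" by (rule int_tensor_product_comm_group[OF A A])
  interpret k: group_hom "int_tensor_product ?A ?A" ?L k using k by unfold_locales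
  have T: "?T \<subseteq> carrier K" by (rule tensors_of_subset) simp
  have "?T \<subseteq> k ` carrier (int_tensor_product ?A ?A)"
  proof clarify
    fix g h assume gh: "g \<in> carrier G" "h \<in> carrier G"
    then have "?D #> g \<in> carrier ?A" "?D #> h \<in> carrier ?A" unfolding Ac by auto
    then show "tensor g h \<in> k ` carrier (int_tensor_product ?A ?A)"
      using kf f[OF gh] simple_tensor_closed[OF A A] by (metis image_eqI)
  qed
  moreover have "subgroup (k ` carrier (int_tensor_product ?A ?A)) K"
    by (rule K.incl_subgroup[OF K.generate_is_subgroup[OF T] k.img_is_subgroup])
  ultimately have "generate K ?T \<subseteq> k ` carrier (int_tensor_product ?A ?A)"
    by (rule K.generate_subgroup_incl)
  then show ?thesis using fin by (rule finite_surj[rotated])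
qed

end

lemma (in normal) kernel_r_coset: "kernel G (G Mod H) (\<lambda>x. H #> x) = H"
proof -
  have "H #> x = H \<longleftrightarrow> x \<in> H" if "x \<in> carrier G" for x
    using coset_join1[OF _ that subgroup_axioms] coset_join2[OF that subgroup_axioms] by blast
  moreover have "\<one>\<^bsub>G Mod H\<^esub> = H" by (simp add: FactGroup_def)
  ultimately show ?thesis using subset by (auto simp: kernel_def)
qed

lemma (in group_hom) finite_if_finite_image_kernel:
  assumes S: "S \<subseteq> carrier G" and img: "finite (h ` S)" and ker: "finite (kernel G H h)"
  shows "finite S"
proof -
  have "finite {x \<in> S. h x = y}" if "y \<in> h ` S" for y
  proof -
    from that obtain s where s: "s \<in> S" "y = h s" by blast
    have "{x \<in> S. h x = y} \<subseteq> (\<lambda>u. u \<otimes> s) ` kernel G H h"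
    proof clarify
      fix x assume x: "x \<in> S" "y = h x"
      have "x \<in> carrier G" "s \<in> carrier G" using x s S by auto
      then have "x \<otimes> inv s \<in> kernel G H h" and "x = x \<otimes> inv s \<otimes> s"
        using x s by (simp_all add: kernel_def G.m_assoc flip: x(2))
      then show "x \<in> (\<lambda>u. u \<otimes> s) ` kernel G H h" by blast
    qed
    then show ?thesis using ker by (rule finite_surj[rotated])
  qed
  then have "finite (\<Union>y\<in>h ` S. {x \<in> S. h x = y})" using img by blast
  then show ?thesis by (rule finite_subset[rotated]) auto
qed

text \<open>Dividing out the finite normal subgroup generated by \<open>[G', G\<^sup>\<phi>]\<close> and \<open>[G'\<^sup>\<phi>, G]\<close> gives the
  situation just treated.\<close>

theorem (in tensor_pair) finite_tensor_square_if_BFC: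
  assumes BFC: "BFC_group G"
    and fin: "finite (carrier (int_tensor_product (abelianization G) (abelianization G)))"
  shows "finite (generate K (tensors_of (carrier G)))"
proof -
  define S where "S = tensors_of (derived G (carrier G)) \<union>
    {commutator K (j c) (i h) | c h. c \<in> derived G (carrier G) \<and> h \<in> carrier G}"
  define M where "M = generate K S"
  have M: "M \<lhd> K" "finite M"
    using finite_generate_tensors_derived[OF BFC] by (simp_all add: M_def S_def)
  interpret M: normal M K by (rule M(1))
  let ?Q = "K Mod M" and ?p = "\<lambda>x. M #>\<^bsub>K\<^esub> x"
  interpret Q: group ?Q by (rule M.factorgroup_is_group)
  interpret p: group_hom K ?Q ?p
    using M.r_coset_hom_Mod by unfold_locales
  have ker: "kernel K ?Q ?p = M" by (rule M.kernel_r_coset)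
  have surj: "?p ` carrier K = carrier ?Q" by (auto simp: FactGroup_def RCOSETS_def)
  interpret Q: tensor_pair ?Q G "\<lambda>g. ?p (i g)" "\<lambda>g. ?p (j g)"
    by (rule hom_image_tensor_pair[OF Q.is_group p.homh surj])
  have Dc: "derived G (carrier G) \<subseteq> carrier G" by (rule G.derived_in_carrier) simp
  have pS: "?p s = \<one>\<^bsub>?Q\<^esub>" if "s \<in> S" for s
  proof -
    have "s \<in> M" unfolding M_def using that by (rule generate.incl)
    then have "s \<in> kernel K ?Q ?p" by (simp only: ker)
    then show ?thesis by (simp add: kernel_def)
  qed
  interpret Q: derived_central_tensor_pair ?Q G "\<lambda>g. ?p (i g)" "\<lambda>g. ?p (j g)"
  proof
    fix c h assume ch: "c \<in> derived G (carrier G)" "h \<in> carrier G"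
    then have c: "c \<in> carrier G" using Dc by blast
    have "tensor c h \<in> S" "commutator K (j c) (i h) \<in> S" unfolding S_def using ch by blast+
    then have *: "?p (tensor c h) = \<one>\<^bsub>?Q\<^esub>" "?p (commutator K (j c) (i h)) = \<one>\<^bsub>?Q\<^esub>"
      using pS by blast+
    show "commutator ?Q (?p (i c)) (?p (j h)) = \<one>\<^bsub>?Q\<^esub>"
      using * c ch by (simp flip: p.hom_commutator)
    have "commutator ?Q (?p (i h)) (?p (j c)) = inv\<^bsub>?Q\<^esub> commutator ?Q (?p (j c)) (?p (i h))"
      using c ch by (simp add: Q.inv_commutator)
    also have "commutator ?Q (?p (j c)) (?p (i h)) = \<one>\<^bsub>?Q\<^esub>"
      using * c ch by (simp flip: p.hom_commutator)
    also have "inv\<^bsub>?Q\<^esub> \<one>\<^bsub>?Q\<^esub> = \<one>\<^bsub>?Q\<^esub>" by (rule Q.inv_one)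
    finally show "commutator ?Q (?p (i h)) (?p (j c)) = \<one>\<^bsub>?Q\<^esub>" .
  qed
  let ?T = "tensors_of (carrier G)"
  have T: "?T \<subseteq> carrier K" by (rule tensors_of_subset) simp
  have "?p ` ?T = Q.tensors_of (carrier G)"
    by (force simp flip: p.hom_commutator)
  then have "?p ` generate K ?T = generate ?Q (Q.tensors_of (carrier G))"
    using p.generate_img[OF T, symmetric] by simp
  then have img: "finite (?p ` generate K ?T)"
    using Q.finite_generate_tensors_if_finite_tensor_product[OF fin] by simp
  show ?thesis
    by (rule p.finite_if_finite_image_kernel[OF K.generate_incl[OF T] img]) (simp only: ker M(2))
qed

section \<open>Homomorphisms out of \<open>\<nu>(G)\<close>\<close>

context
  fixes G :: "('a, 'm) monoid_scheme" and H :: "('b, 'n) monoid_scheme" and \<phi>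
  assumes G: "group G" and H: "group H" and \<phi>: "\<phi> \<in> iso G H"
begin

private abbreviation (input) "P \<equiv> free_product G H"
private abbreviation (input) "N \<equiv> normal_closure P (nu_relators G H \<phi>)"

lemma nu_relatorI:
  assumes "g \<in> carrier G" "h \<in> carrier G" "k \<in> carrier G"
  shows "conjugate P (commutator P (fp_inl G H g) (fp_inr G H (\<phi> h))) (fp_inl G H k) \<otimes>\<^bsub>P\<^esub>
      inv\<^bsub>P\<^esub> commutator P (fp_inl G H (conjugate G g k)) (fp_inr G H (\<phi> (conjugate G h k)))
      \<in> nu_relators G H \<phi>"
    and "commutator P (fp_inl G H (conjugate G g k)) (fp_inr G H (\<phi> (conjugate G h k))) \<otimes>\<^bsub>P\<^esub>
      inv\<^bsub>P\<^esub> conjugate P (commutator P (fp_inl G H g) (fp_inr G H (\<phi> h))) (fp_inr G H (\<phi> k))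
      \<in> nu_relators G H \<phi>"
  using assms unfolding nu_relators_def Let_def by blast+

lemma nu_tensor_pair: "tensor_pair (nu G H \<phi>) G (nu_base G H \<phi>) (nu_copy G H \<phi>)"
proof -
  interpret G: group G by (rule G)
  interpret H: group H by (rule H)
  interpret P: group P by (rule free_product_group[OF G H])
  interpret V: group "nu G H \<phi>" by (rule nu_group[OF G H \<phi>])
  interpret N: normal N P by (rule nu_kernel_normal[OF G H \<phi>])
  let ?V = "nu G H \<phi>" and ?p = "\<lambda>x. N #>\<^bsub>P\<^esub> x"
  have "?p \<in> hom P ?V" unfolding nu_def by (rule N.r_coset_hom_Mod)
  then interpret p: group_hom P ?V ?p by unfold_locales
  let ?i = "fp_inl G H" and ?j = "\<lambda>g. fp_inr G H (\<phi> g)"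
  have i: "?i g \<in> carrier P" and j: "?j g \<in> carrier P" if "g \<in> carrier G" for g
    using that hom_in_carrier[OF fp_inl_hom[OF G H]] hom_in_carrier[OF fp_inr_hom[OF G H]]
      hom_in_carrier[OF iso_imp_homomorphism[OF \<phi>]] by auto
  have eq: "?p u = ?p v"
    if "u \<otimes>\<^bsub>P\<^esub> inv\<^bsub>P\<^esub> v \<in> nu_relators G H \<phi>" "u \<in> carrier P" "v \<in> carrier P" for u v
  proof -
    have "u \<otimes>\<^bsub>P\<^esub> inv\<^bsub>P\<^esub> v \<in> N"
      using that(1) normal_closure_superset[of "nu_relators G H \<phi>" P] by blast
    then show ?thesis
      using that(2,3) by (metis N.rcos_module_rev N.subgroup_axioms P.is_group P.repr_independence)
  qed
  show ?thesis
  proof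
    show "nu_base G H \<phi> \<in> hom G ?V" by (rule nu_base_hom[OF G H \<phi>])
    show "nu_copy G H \<phi> \<in> hom G ?V" by (rule nu_copy_hom[OF G H \<phi>])
    have "carrier H = \<phi> ` carrier G" using \<phi> by (auto simp: iso_def bij_betw_def)
    then have jH: "fp_inr G H ` carrier H = ?j ` carrier G" by (simp add: image_image)
    have "carrier ?V = ?p ` carrier P"
      unfolding nu_def by (auto simp: FactGroup_def RCOSETS_def)
    also have "carrier P = generate P (?i ` carrier G \<union> ?j ` carrier G)"
      using free_product_generate[OF G H] jH by simp
    also have "?p ` generate P (?i ` carrier G \<union> ?j ` carrier G) =
        generate ?V (?p ` (?i ` carrier G \<union> ?j ` carrier G))"
      using i j by (intro p.generate_img[symmetric]) auto
    also have "?p ` (?i ` carrier G \<union> ?j ` carrier G) =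
        nu_base G H \<phi> ` carrier G \<union> nu_copy G H \<phi> ` carrier G"
      by (simp add: image_Un image_image nu_base_def nu_copy_def)
    finally show "carrier ?V =
        generate ?V (nu_base G H \<phi> ` carrier G \<union> nu_copy G H \<phi> ` carrier G)" .
  next
    fix g h k assume ghk: "g \<in> carrier G" "h \<in> carrier G" "k \<in> carrier G"
    have c: "conjugate G g k \<in> carrier G" "conjugate G h k \<in> carrier G" using ghk by auto
    let ?m = "commutator P (?i (conjugate G g k)) (?j (conjugate G h k))"
    have "?p (conjugate P (commutator P (?i g) (?j h)) (?i k)) = ?p ?m"
      using nu_relatorI(1)[OF ghk] by (rule eq) (use i j ghk c in auto)
    then show "conjugate ?V (commutator ?V (nu_base G H \<phi> g) (nu_copy G H \<phi> h)) (nu_base G H \<phi> k) =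
        commutator ?V (nu_base G H \<phi> (conjugate G g k)) (nu_copy G H \<phi> (conjugate G h k))"
      using i j ghk c by (simp add: p.hom_conjugate p.hom_commutator nu_base_def nu_copy_def)
    have "?p ?m = ?p (conjugate P (commutator P (?i g) (?j h)) (?j k))"
      using nu_relatorI(2)[OF ghk] by (rule eq) (use i j ghk c in auto)
    then show "conjugate ?V (commutator ?V (nu_base G H \<phi> g) (nu_copy G H \<phi> h)) (nu_copy G H \<phi> k) =
        commutator ?V (nu_base G H \<phi> (conjugate G g k)) (nu_copy G H \<phi> (conjugate G h k))"
      using i j ghk c by (simp add: p.hom_conjugate p.hom_commutator nu_base_def nu_copy_def)
  qed
qed

text \<open>The relators lie in the kernel of the map that the free product induces.\<close>

lemma nu_universal:
  assumes K: "group K" and f: "f \<in> hom G K" and f': "f' \<in> hom G K"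
    and base: "\<And>g h k. \<lbrakk>g \<in> carrier G; h \<in> carrier G; k \<in> carrier G\<rbrakk> \<Longrightarrow>
      conjugate K (commutator K (f g) (f' h)) (f k) =
      commutator K (f (conjugate G g k)) (f' (conjugate G h k))"
    and copy: "\<And>g h k. \<lbrakk>g \<in> carrier G; h \<in> carrier G; k \<in> carrier G\<rbrakk> \<Longrightarrow>
      conjugate K (commutator K (f g) (f' h)) (f' k) =
      commutator K (f (conjugate G g k)) (f' (conjugate G h k))"
  obtains \<psi> where "\<psi> \<in> hom (nu G H \<phi>) K"
    "\<And>g. g \<in> carrier G \<Longrightarrow> \<psi> (nu_base G H \<phi> g) = f g"
    "\<And>g. g \<in> carrier G \<Longrightarrow> \<psi> (nu_copy G H \<phi> g) = f' g"
proof -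
  interpret G: group G by (rule G)
  interpret H: group H by (rule H)
  interpret K: group K by (rule K)
  interpret P: group P by (rule free_product_group[OF G H])
  interpret f: group_hom G K f using f by unfold_locales
  interpret f': group_hom G K f' using f' by unfold_locales
  let ?i = "fp_inl G H" and ?j = "\<lambda>g. fp_inr G H (\<phi> g)"
  have \<phi>c: "\<phi> g \<in> carrier H" if "g \<in> carrier G" for g
    using hom_in_carrier[OF iso_imp_homomorphism[OF \<phi>] that] .
  have i: "?i g \<in> carrier P" and j: "?j g \<in> carrier P" if "g \<in> carrier G" for g
    using that hom_in_carrier[OF fp_inl_hom[OF G H]] hom_in_carrier[OF fp_inr_hom[OF G H]] \<phi>c
    by auto
  have "inv_into (carrier G) \<phi> \<in> hom H G"
    using G.iso_set_sym[OF \<phi>] by (rule iso_imp_homomorphism)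
  then have "f' \<circ> inv_into (carrier G) \<phi> \<in> hom H K" using f' by (rule hom_compose)
  then obtain \<theta> where \<theta>: "\<theta> \<in> hom P K" "\<And>x. x \<in> carrier G \<Longrightarrow> \<theta> (?i x) = f x"
    "\<And>y. y \<in> carrier H \<Longrightarrow> \<theta> (fp_inr G H y) = (f' \<circ> inv_into (carrier G) \<phi>) y"
    using free_product_universal[OF G H K f] by blast
  have \<theta>j: "\<theta> (?j g) = f' g" if "g \<in> carrier G" for g
    using that \<phi> \<phi>c \<theta>(3) by (simp add: iso_def bij_betw_def)
  interpret \<theta>: group_hom P K \<theta> using \<theta>(1) by unfold_locales
  have "r \<in> kernel P K \<theta>" if r: "r \<in> nu_relators G H \<phi>" for r
  proof -
    have rc: "r \<in> carrier P" using r nu_relators_subset[OF G H \<phi>] by blast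
    have "\<theta> r = \<one>\<^bsub>K\<^esub>"
      using r unfolding nu_relators_def Let_def
      by (auto simp: \<theta>.hom_conjugate \<theta>.hom_commutator \<theta>(2) \<theta>j i j base copy)
    with rc show ?thesis by (simp add: kernel_def)
  qed
  then have "N \<subseteq> kernel P K \<theta>"
    by (intro normal_closure_least \<theta>.normal_kernel) blast
  then obtain \<psi> where \<psi>: "\<psi> \<in> hom (P Mod N) K" "\<And>x. x \<in> carrier P \<Longrightarrow> \<psi> (N #>\<^bsub>P\<^esub> x) = \<theta> x"
    using \<theta>.FactGroup_universal_kernel[OF nu_kernel_normal[OF G H \<phi>]] by blast
  show thesis
  proof
    show "\<psi> \<in> hom (nu G H \<phi>) K" using \<psi>(1) by (simp add: nu_def)
    show "\<psi> (nu_base G H \<phi> g) = f g" "\<psi> (nu_copy G H \<phi> g) = f' g" if "g \<in> carrier G" for g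
      unfolding nu_base_def nu_copy_def using that by (simp_all add: \<psi>(2) i j \<theta>(2) \<theta>j)
  qed
qed

lemma nu_collapse:
  obtains \<kappa> where "\<kappa> \<in> hom (nu G H \<phi>) G"
    "\<And>g. g \<in> carrier G \<Longrightarrow> \<kappa> (nu_base G H \<phi> g) = g"
    "\<And>g. g \<in> carrier G \<Longrightarrow> \<kappa> (nu_copy G H \<phi> g) = g"
proof -
  interpret G: group G by (rule G)
  show thesis
    by (rule nu_universal[OF G, of "\<lambda>x. x" "\<lambda>x. x"])
      (auto simp: hom_def G.conjugate_commutator intro: that)
qed

end

section \<open>A Heisenberg group\<close>

text \<open>For a biadditive \<open>\<beta>\<close>, the triples \<open>(a, b, c)\<close> behave like upper unitriangular matrices with
  entries \<open>a\<close>, \<open>b\<close> beside the diagonal and \<open>c\<close> in the corner; the commutator of \<open>(a, 1, 1)\<close> and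
  \<open>(1, b, 1)\<close> is \<open>(1, 1, \<beta> a b)\<close>.\<close>

definition heisenberg ::
  "('a, 'm) monoid_scheme \<Rightarrow> ('b, 'n) monoid_scheme \<Rightarrow> ('c, 'p) monoid_scheme \<Rightarrow>
     ('a \<Rightarrow> 'b \<Rightarrow> 'c) \<Rightarrow> ('a \<times> 'b \<times> 'c) monoid" where
  "heisenberg A B C \<beta> =
     \<lparr>carrier = carrier A \<times> carrier B \<times> carrier C,
      monoid.mult = (\<lambda>(a, b, c) (a', b', c').
        (a \<otimes>\<^bsub>A\<^esub> a', b \<otimes>\<^bsub>B\<^esub> b', c \<otimes>\<^bsub>C\<^esub> c' \<otimes>\<^bsub>C\<^esub> \<beta> a b')),
      one = (\<one>\<^bsub>A\<^esub>, \<one>\<^bsub>B\<^esub>, \<one>\<^bsub>C\<^esub>)\<rparr>"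

locale biadditive = A: comm_group A + B: comm_group B + C: comm_group C
  for A :: "('a, 'm) monoid_scheme" and B :: "('b, 'n) monoid_scheme"
    and C :: "('c, 'p) monoid_scheme" +
  fixes \<beta> :: "'a \<Rightarrow> 'b \<Rightarrow> 'c"
  assumes closed [simp]: "\<lbrakk>a \<in> carrier A; b \<in> carrier B\<rbrakk> \<Longrightarrow> \<beta> a b \<in> carrier C"
    and left [simp]: "\<lbrakk>a \<in> carrier A; a' \<in> carrier A; b \<in> carrier B\<rbrakk> \<Longrightarrow>
        \<beta> (a \<otimes>\<^bsub>A\<^esub> a') b = \<beta> a b \<otimes>\<^bsub>C\<^esub> \<beta> a' b"
    and right [simp]: "\<lbrakk>a \<in> carrier A; b \<in> carrier B; b' \<in> carrier B\<rbrakk> \<Longrightarrow>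
        \<beta> a (b \<otimes>\<^bsub>B\<^esub> b') = \<beta> a b \<otimes>\<^bsub>C\<^esub> \<beta> a b'"
begin

abbreviation "\<H> \<equiv> heisenberg A B C \<beta>"

lemma one_left [simp]: "b \<in> carrier B \<Longrightarrow> \<beta> \<one>\<^bsub>A\<^esub> b = \<one>\<^bsub>C\<^esub>"
  using left[of "\<one>\<^bsub>A\<^esub>" "\<one>\<^bsub>A\<^esub>" b] closed[of "\<one>\<^bsub>A\<^esub>" b]
  by (metis A.l_one A.one_closed C.r_cancel_one)

lemma one_right [simp]: "a \<in> carrier A \<Longrightarrow> \<beta> a \<one>\<^bsub>B\<^esub> = \<one>\<^bsub>C\<^esub>"
  using right[of a "\<one>\<^bsub>B\<^esub>" "\<one>\<^bsub>B\<^esub>"] closed[of a "\<one>\<^bsub>B\<^esub>"]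
  by (metis B.l_one B.one_closed C.r_cancel_one)

lemma heisenberg_simps [simp]:
  "(a, b, c) \<in> carrier \<H> \<longleftrightarrow> a \<in> carrier A \<and> b \<in> carrier B \<and> c \<in> carrier C"
  "(a, b, c) \<otimes>\<^bsub>\<H>\<^esub> (a', b', c') = (a \<otimes>\<^bsub>A\<^esub> a', b \<otimes>\<^bsub>B\<^esub> b', c \<otimes>\<^bsub>C\<^esub> c' \<otimes>\<^bsub>C\<^esub> \<beta> a b')"
  "\<one>\<^bsub>\<H>\<^esub> = (\<one>\<^bsub>A\<^esub>, \<one>\<^bsub>B\<^esub>, \<one>\<^bsub>C\<^esub>)"
  by (simp_all add: heisenberg_def)

lemma group_heisenberg: "group \<H>"
proof (rule groupI)
  fix x assume x: "x \<in> carrier \<H>"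
  obtain a b c where abc: "x = (a, b, c)" using prod_cases3 by blast
  \<comment> \<open>The corner of \<open>y x\<close> is the corner of \<open>y\<close> times \<open>c\<close> and \<open>\<beta> (inv a) b\<close>.\<close>
  let ?y = "(inv\<^bsub>A\<^esub> a, inv\<^bsub>B\<^esub> b, inv\<^bsub>C\<^esub> (c \<otimes>\<^bsub>C\<^esub> \<beta> (inv\<^bsub>A\<^esub> a) b))"
  have "inv\<^bsub>C\<^esub> (c \<otimes>\<^bsub>C\<^esub> \<beta> (inv\<^bsub>A\<^esub> a) b) \<otimes>\<^bsub>C\<^esub> c \<otimes>\<^bsub>C\<^esub> \<beta> (inv\<^bsub>A\<^esub> a) b = \<one>\<^bsub>C\<^esub>"
    using x abc by (simp add: C.m_assoc)
  then show "\<exists>y\<in>carrier \<H>. y \<otimes>\<^bsub>\<H>\<^esub> x = \<one>\<^bsub>\<H>\<^esub>"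
    using x abc by (intro bexI[of _ ?y]) auto
  show "\<one>\<^bsub>\<H>\<^esub> \<otimes>\<^bsub>\<H>\<^esub> x = x" using x abc by simp
next
  fix x y z assume "x \<in> carrier \<H>" "y \<in> carrier \<H>" "z \<in> carrier \<H>"
  then show "x \<otimes>\<^bsub>\<H>\<^esub> y \<otimes>\<^bsub>\<H>\<^esub> z = x \<otimes>\<^bsub>\<H>\<^esub> (y \<otimes>\<^bsub>\<H>\<^esub> z)"
    by (cases x, cases y, cases z) (auto simp: A.m_assoc B.m_assoc C.m_ac)
qed (auto simp: heisenberg_def)

lemma commutator_heisenberg:
  assumes a: "a \<in> carrier A" and b: "b \<in> carrier B"
  shows "commutator \<H> (a, \<one>\<^bsub>B\<^esub>, \<one>\<^bsub>C\<^esub>) (\<one>\<^bsub>A\<^esub>, b, \<one>\<^bsub>C\<^esub>) = (\<one>\<^bsub>A\<^esub>, \<one>\<^bsub>B\<^esub>, \<beta> a b)"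
proof -
  interpret H: group \<H> by (rule group_heisenberg)
  let ?x = "(a, \<one>\<^bsub>B\<^esub>, \<one>\<^bsub>C\<^esub>)" and ?y = "(\<one>\<^bsub>A\<^esub>, b, \<one>\<^bsub>C\<^esub>)" and ?z = "(\<one>\<^bsub>A\<^esub>, \<one>\<^bsub>B\<^esub>, \<beta> a b)"
  have xyz: "?x \<in> carrier \<H>" "?y \<in> carrier \<H>" "?z \<in> carrier \<H>" using a b by auto
  have "?x \<otimes>\<^bsub>\<H>\<^esub> ?y = ?y \<otimes>\<^bsub>\<H>\<^esub> ?x \<otimes>\<^bsub>\<H>\<^esub> ?z" using a b by simp
  then have "inv\<^bsub>\<H>\<^esub> (?y \<otimes>\<^bsub>\<H>\<^esub> ?x) \<otimes>\<^bsub>\<H>\<^esub> (?x \<otimes>\<^bsub>\<H>\<^esub> ?y) = ?z"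
    using xyz by (simp only: H.m_assoc[of "inv\<^bsub>\<H>\<^esub> (?y \<otimes>\<^bsub>\<H>\<^esub> ?x)", symmetric] H.m_closed
        H.inv_closed H.l_inv H.l_one)
  moreover have "commutator \<H> ?x ?y = inv\<^bsub>\<H>\<^esub> (?y \<otimes>\<^bsub>\<H>\<^esub> ?x) \<otimes>\<^bsub>\<H>\<^esub> (?x \<otimes>\<^bsub>\<H>\<^esub> ?y)"
    using xyz unfolding commutator_def
    by (simp only: H.inv_mult_group H.m_assoc H.m_closed H.inv_closed)
  ultimately show ?thesis by simp
qed

lemma conjugate_center_heisenberg:
  assumes c: "c \<in> carrier C" and x: "x \<in> carrier \<H>"
  shows "conjugate \<H> (\<one>\<^bsub>A\<^esub>, \<one>\<^bsub>B\<^esub>, c) x = (\<one>\<^bsub>A\<^esub>, \<one>\<^bsub>B\<^esub>, c)"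
proof -
  interpret H: group \<H> by (rule group_heisenberg)
  have "(\<one>\<^bsub>A\<^esub>, \<one>\<^bsub>B\<^esub>, c) \<otimes>\<^bsub>\<H>\<^esub> x = x \<otimes>\<^bsub>\<H>\<^esub> (\<one>\<^bsub>A\<^esub>, \<one>\<^bsub>B\<^esub>, c)"
    using c x by (cases x) (auto simp: C.m_comm)
  then show ?thesis using c x by (subst H.conjugate_eq_self_iff) auto
qed

end

section \<open>Commuting copies of \<open>G\<close>\<close>

text \<open>The case of trivial tensors is that of a homomorphic image of \<open>G \<times> G\<close>.\<close>

context tensor_pair
begin

context
  assumes trivial: "\<And>g h. \<lbrakk>g \<in> carrier G; h \<in> carrier G\<rbrakk> \<Longrightarrow> tensor g h = \<one>\<^bsub>K\<^esub>"
begin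

lemma images_commute:
  "\<lbrakk>g \<in> carrier G; h \<in> carrier G\<rbrakk> \<Longrightarrow> i g \<otimes>\<^bsub>K\<^esub> j h = j h \<otimes>\<^bsub>K\<^esub> i g"
  using trivial[of g h] by (simp add: K.commutator_eq_one_iff)

lemma product_form:
  assumes "x \<in> carrier K"
  shows "\<exists>g\<in>carrier G. \<exists>h\<in>carrier G. x = i g \<otimes>\<^bsub>K\<^esub> j h"
  using assms unfolding generated
proof (induction rule: generate.induct)
  case one
  then show ?case by (intro bexI[of _ \<one>]) auto
next
  case (incl x)
  then show ?case
  proof
    assume "x \<in> i ` carrier G"
    then obtain g where "g \<in> carrier G" "x = i g \<otimes>\<^bsub>K\<^esub> j \<one>" by auto
    then show ?thesis by blast
  next
    assume "x \<in> j ` carrier G"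
    then obtain g where "g \<in> carrier G" "x = i \<one> \<otimes>\<^bsub>K\<^esub> j g" by auto
    then show ?thesis by blast
  qed
next
  case (inv x)
  then show ?case
  proof
    assume "x \<in> i ` carrier G"
    then obtain g where "g \<in> carrier G" "inv\<^bsub>K\<^esub> x = i (inv g) \<otimes>\<^bsub>K\<^esub> j \<one>" by auto
    then show ?thesis by blast
  next
    assume "x \<in> j ` carrier G"
    then obtain g where "g \<in> carrier G" "inv\<^bsub>K\<^esub> x = i \<one> \<otimes>\<^bsub>K\<^esub> j (inv g)" by auto
    then show ?thesis by blast
  qed
next
  case (eng x y)
  then obtain g h g' h' where gh: "g \<in> carrier G" "h \<in> carrier G" "g' \<in> carrier G" "h' \<in> carrier G"
    "x = i g \<otimes>\<^bsub>K\<^esub> j h" "y = i g' \<otimes>\<^bsub>K\<^esub> j h'" by blast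
  have "x \<otimes>\<^bsub>K\<^esub> y = i g \<otimes>\<^bsub>K\<^esub> (j h \<otimes>\<^bsub>K\<^esub> i g') \<otimes>\<^bsub>K\<^esub> j h'" using gh by (simp add: K.m_assoc)
  also have "\<dots> = i (g \<otimes> g') \<otimes>\<^bsub>K\<^esub> j (h \<otimes> h')"
    using gh by (simp add: K.m_assoc flip: images_commute)
  finally show ?case using gh by blast
qed

lemma commutator_product_form:
  assumes "g \<in> carrier G" "h \<in> carrier G" "g' \<in> carrier G" "h' \<in> carrier G"
  shows "commutator K (i g \<otimes>\<^bsub>K\<^esub> j h) (i g' \<otimes>\<^bsub>K\<^esub> j h') =
    i (commutator G g g') \<otimes>\<^bsub>K\<^esub> j (commutator G h h')"
proof -
  have conj: "conjugate K (i x) (j y) = i x" if "x \<in> carrier G" "y \<in> carrier G" for x y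
    using that by (simp add: K.conjugate_eq_self_iff images_commute)
  have "commutator K (j h) (i g') = \<one>\<^bsub>K\<^esub>"
    using assms by (simp add: K.commutator_eq_one_iff images_commute)
  then show ?thesis
    using assms by (simp add: K.commutator_mult_left K.commutator_mult_right trivial conj
        images_commute[of "commutator G g g'" "commutator G h h'"]
        flip: i.hom_commutator j.hom_commutator)
qed

end

end

section \<open>Finiteness of tensors and of commutators in \<open>\<nu>(G)\<close>\<close>

context
  fixes G :: "('a, 'm) monoid_scheme" and H :: "('b, 'n) monoid_scheme" and \<phi>
  assumes G: "group G" and H: "group H" and \<phi>: "\<phi> \<in> iso G H"
begin

private abbreviation (input) "V \<equiv> nu G H \<phi>"

interpretation G: group G by (rule G)
interpretation V: tensor_pair V G "nu_base G H \<phi>" "nu_copy G H \<phi>"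
  by (rule nu_tensor_pair[OF G H \<phi>])

lemma tensors_eq: "tensors G H \<phi> = V.tensors_of (carrier G)"
  by (simp add: tensors_def)

text \<open>The collapse \<open>\<nu>(G) \<rightarrow> G\<close> that forgets \<open>\<phi>\<close> maps tensors onto commutators.\<close>

lemma finite_commutators_if_finite_tensors:
  assumes "finite (tensors G H \<phi>)"
  shows "finite {commutator G x y | x y. x \<in> carrier G \<and> y \<in> carrier G}"
proof -
  obtain \<kappa> where \<kappa>: "\<kappa> \<in> hom V G" "\<And>g. g \<in> carrier G \<Longrightarrow> \<kappa> (nu_base G H \<phi> g) = g"
    "\<And>g. g \<in> carrier G \<Longrightarrow> \<kappa> (nu_copy G H \<phi> g) = g"
    using nu_collapse[OF G H \<phi>] by blast
  interpret \<kappa>: group_hom V G \<kappa> using \<kappa>(1) by unfold_locales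
  have "{commutator G x y | x y. x \<in> carrier G \<and> y \<in> carrier G} \<subseteq> \<kappa> ` tensors G H \<phi>"
  proof clarify
    fix x y assume xy: "x \<in> carrier G" "y \<in> carrier G"
    have "commutator G x y = \<kappa> (V.tensor x y)"
      using xy by (simp add: \<kappa>.hom_commutator \<kappa>(2,3))
    then show "commutator G x y \<in> \<kappa> ` tensors G H \<phi>"
      using xy unfolding tensors_def by blast
  qed
  then show ?thesis using assms by (rule finite_surj[rotated])
qed

text \<open>The Heisenberg group of the universal biadditive map on \<open>G\<^sup>a\<^sup>b\<close> receives \<open>\<nu>(G)\<close>: tensors go to its
  centre, which conjugation fixes, and conjugate elements of \<open>G\<close> agree in \<open>G\<^sup>a\<^sup>b\<close>.\<close>

lemma finite_tensor_product_if_finite_tensors: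
  assumes "finite (tensors G H \<phi>)"
  shows "finite (carrier (int_tensor_product (abelianization G) (abelianization G)))"
proof -
  let ?A = "abelianization G" and ?D = "derived G (carrier G)"
  let ?P = "int_tensor_product ?A ?A"
  let ?\<beta> = "simple_tensor ?A ?A"
  interpret A: comm_group ?A unfolding abelianization_def by (rule G.derived_quot_is_comm_group)
  interpret P: comm_group ?P by (rule int_tensor_product_comm_group[OF A.is_group A.is_group])
  interpret b: biadditive ?A ?A ?P ?\<beta>
    by unfold_locales (simp_all add: simple_tensor_closed simple_tensor_mult_left
        simple_tensor_mult_right A.is_group)
  interpret h: group b.\<H> by (rule b.group_heisenberg)
  let ?q = "\<lambda>g. ?D #>\<^bsub>G\<^esub> g"
  have "?q \<in> hom G ?A"
    unfolding abelianization_def by (rule normal.r_coset_hom_Mod[OF G.derived_self_is_normal])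
  then interpret q: group_hom G ?A ?q by unfold_locales
  have conj: "?q (conjugate G g k) = ?q g" if "g \<in> carrier G" "k \<in> carrier G" for g k
  proof -
    have "?q (conjugate G g k) = conjugate ?A (?q g) (?q k)" using that by (rule q.hom_conjugate)
    also have "\<dots> = ?q g"
      using that by (subst A.conjugate_eq_self_iff) (simp_all add: A.m_comm)
    finally show ?thesis .
  qed
  define f where "f g = (?q g, \<one>\<^bsub>?A\<^esub>, \<one>\<^bsub>?P\<^esub>)" for g
  define f' where "f' g = (\<one>\<^bsub>?A\<^esub>, ?q g, \<one>\<^bsub>?P\<^esub>)" for g
  have f: "f \<in> hom G b.\<H>" and f': "f' \<in> hom G b.\<H>"
    by (rule homI; simp add: f_def f'_def)+
  have fc: "f g \<in> carrier b.\<H>" "f' g \<in> carrier b.\<H>" if "g \<in> carrier G" for g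
    using that f f' by (auto simp: hom_def)
  have comm: "commutator b.\<H> (f g) (f' h) = (\<one>\<^bsub>?A\<^esub>, \<one>\<^bsub>?A\<^esub>, ?\<beta> (?q g) (?q h))"
    if "g \<in> carrier G" "h \<in> carrier G" for g h
    unfolding f_def f'_def using that by (intro b.commutator_heisenberg) simp_all
  obtain \<psi> where \<psi>: "\<psi> \<in> hom V b.\<H>" "\<And>g. g \<in> carrier G \<Longrightarrow> \<psi> (nu_base G H \<phi> g) = f g"
    "\<And>g. g \<in> carrier G \<Longrightarrow> \<psi> (nu_copy G H \<phi> g) = f' g"
  proof (rule nu_universal[OF G H \<phi> h.is_group f f'])
    fix g h k assume ghk: "g \<in> carrier G" "h \<in> carrier G" "k \<in> carrier G"
    then show "conjugate b.\<H> (commutator b.\<H> (f g) (f' h)) (f k) =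
        commutator b.\<H> (f (conjugate G g k)) (f' (conjugate G h k))"
      "conjugate b.\<H> (commutator b.\<H> (f g) (f' h)) (f' k) =
        commutator b.\<H> (f (conjugate G g k)) (f' (conjugate G h k))"
      by (simp_all add: comm conj b.conjugate_center_heisenberg fc)
  qed blast
  interpret \<psi>: group_hom V b.\<H> \<psi> using \<psi>(1) by unfold_locales
  have "{?\<beta> a b | a b. a \<in> carrier ?A \<and> b \<in> carrier ?A} \<subseteq> (\<lambda>t. snd (snd (\<psi> t))) ` tensors G H \<phi>"
  proof clarify
    fix a b assume "a \<in> carrier ?A" "b \<in> carrier ?A"
    then obtain g h where gh: "g \<in> carrier G" "h \<in> carrier G" "a = ?q g" "b = ?q h"
      by (auto simp: abelianization_def FactGroup_def RCOSETS_def)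
    then have "?\<beta> a b = snd (snd (\<psi> (V.tensor g h)))"
      by (simp add: \<psi>.hom_commutator \<psi>(2,3) comm)
    moreover have "V.tensor g h \<in> tensors G H \<phi>" using gh unfolding tensors_def by blast
    ultimately show "?\<beta> a b \<in> (\<lambda>t. snd (snd (\<psi> t))) ` tensors G H \<phi>" by (rule image_eqI)
  qed
  then have "finite {?\<beta> a b | a b. a \<in> carrier ?A \<and> b \<in> carrier ?A}"
    using assms by (rule finite_surj[rotated])
  then show ?thesis by (rule finite_int_tensor_product[OF A.is_group A.is_group])
qed

text \<open>Modulo the tensor square \<open>N\<close> the two copies of \<open>G\<close> commute, so every element of \<open>\<nu>(G)\<close> is
  congruent to some \<open>g h\<^sup>\<phi>\<close>, and a commutator in \<open>\<nu>(G)\<close> is congruent to \<open>[g, g'] [h, h']\<^sup>\<phi>\<close>.\<close>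

lemma finite_nu_commutators_if_finite_tensor_square:
  assumes fin: "finite (nonabelian_tensor_square G H \<phi>)"
  shows "finite {commutator V \<alpha> \<beta> | \<alpha> \<beta>. \<alpha> \<in> carrier V \<and> \<beta> \<in> carrier V}" (is "finite ?C")
proof -
  let ?i = "nu_base G H \<phi>" and ?j = "nu_copy G H \<phi>"
  let ?T = "V.tensors_of (carrier G)"
  define N where "N = generate V ?T"
  have finN: "finite N"
    using fin by (simp add: N_def nonabelian_tensor_square_def tensors_eq)
  have T: "?T \<subseteq> carrier V" by (rule V.tensors_of_subset) simp
  have "N \<lhd> V"
    unfolding N_def using T V.conjugate_tensors_of[OF G.normal_self]
    by (rule V.K.normal_generate_if_conjugate_closed)
  then interpret N: normal N V .
  let ?Q = "V Mod N" and ?p = "\<lambda>x. N #>\<^bsub>V\<^esub> x"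
  interpret Q: group ?Q by (rule N.factorgroup_is_group)
  interpret p: group_hom V ?Q ?p using N.r_coset_hom_Mod by unfold_locales
  have ker: "kernel V ?Q ?p = N" by (rule N.kernel_r_coset)
  have surj: "?p ` carrier V = carrier ?Q" by (auto simp: FactGroup_def RCOSETS_def)
  interpret Q: tensor_pair ?Q G "\<lambda>g. ?p (?i g)" "\<lambda>g. ?p (?j g)"
    by (rule V.hom_image_tensor_pair[OF Q.is_group p.homh surj])
  have triv: "Q.tensor g h = \<one>\<^bsub>?Q\<^esub>" if gh: "g \<in> carrier G" "h \<in> carrier G" for g h
  proof -
    have "V.tensor g h \<in> N" unfolding N_def using gh by (intro generate.incl) blast
    then have "V.tensor g h \<in> kernel V ?Q ?p" by (simp only: ker)
    then show ?thesis using gh by (simp add: kernel_def p.hom_commutator)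
  qed
  let ?CG = "{commutator G x y | x y. x \<in> carrier G \<and> y \<in> carrier G}"
  have "tensors G H \<phi> \<subseteq> nonabelian_tensor_square G H \<phi>"
    unfolding nonabelian_tensor_square_def by (blast intro: generate.incl)
  then have "finite (tensors G H \<phi>)" using fin by (rule finite_subset)
  then have finCG: "finite ?CG" by (rule finite_commutators_if_finite_tensors)
  have "?p ` ?C \<subseteq> (\<lambda>(c, d). ?p (?i c) \<otimes>\<^bsub>?Q\<^esub> ?p (?j d)) ` (?CG \<times> ?CG)"
  proof clarify
    fix x y assume xy: "x \<in> carrier V" "y \<in> carrier V"
    obtain g h g' h' where gh: "g \<in> carrier G" "h \<in> carrier G" "g' \<in> carrier G" "h' \<in> carrier G"
      "?p x = ?p (?i g) \<otimes>\<^bsub>?Q\<^esub> ?p (?j h)" "?p y = ?p (?i g') \<otimes>\<^bsub>?Q\<^esub> ?p (?j h')"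
      using Q.product_form[OF triv p.hom_closed[OF xy(1)]] Q.product_form[OF triv p.hom_closed[OF xy(2)]]
      by metis
    have "?p (commutator V x y) =
      ?p (?i (commutator G g g')) \<otimes>\<^bsub>?Q\<^esub> ?p (?j (commutator G h h'))"
      using xy gh(5,6) Q.commutator_product_form[OF triv gh(1-4)] by (simp add: p.hom_commutator)
    then show "?p (commutator V x y) \<in> (\<lambda>(c, d). ?p (?i c) \<otimes>\<^bsub>?Q\<^esub> ?p (?j d)) ` (?CG \<times> ?CG)"
      using gh(1-4)
      by (intro image_eqI[of _ _ "(commutator G g g', commutator G h h')"]) auto
  qed
  then have img: "finite (?p ` ?C)"
    by (rule finite_subset) (intro finite_imageI finite_cartesian_product finCG)
  have C: "?C \<subseteq> carrier V" by auto
  show ?thesis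
    by (rule p.finite_if_finite_image_kernel[OF C img]) (simp only: ker finN)
qed

end

theorem theorem2p9:
  fixes G :: "('a, 'm) monoid_scheme" and G\<phi> :: "('b, 'n) monoid_scheme" and \<phi> :: "'a \<Rightarrow> 'b"
  assumes "group G" and "group G\<phi>" and "\<phi> \<in> iso G G\<phi>"
  shows "let \<nu> = nu G G\<phi> \<phi> in
         (BFC_group \<nu>
            \<longleftrightarrow> finite {commutator \<nu> \<alpha> \<beta> | \<alpha> \<beta>. \<alpha> \<in> carrier \<nu> \<and> \<beta> \<in> carrier \<nu>})
       \<and> (finite {commutator \<nu> \<alpha> \<beta> | \<alpha> \<beta>. \<alpha> \<in> carrier \<nu> \<and> \<beta> \<in> carrier \<nu>}
            \<longleftrightarrow> finite (derived \<nu> (carrier \<nu>)))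
       \<and> (finite (derived \<nu> (carrier \<nu>))
            \<longleftrightarrow> finite (nonabelian_tensor_square G G\<phi> \<phi>))
       \<and> (finite (nonabelian_tensor_square G G\<phi> \<phi>)
            \<longleftrightarrow> BFC_group G \<and>
                finite (carrier (int_tensor_product (abelianization G) (abelianization G))))
       \<and> (BFC_group G \<and>
          finite (carrier (int_tensor_product (abelianization G) (abelianization G)))
            \<longleftrightarrow> finite (tensors G G\<phi> \<phi>))"
proof -
  let ?V = "nu G G\<phi> \<phi>"
  let ?b = "finite {commutator ?V \<alpha> \<beta> | \<alpha> \<beta>. \<alpha> \<in> carrier ?V \<and> \<beta> \<in> carrier ?V}"
  let ?c = "finite (derived ?V (carrier ?V))"
  let ?d = "finite (nonabelian_tensor_square G G\<phi> \<phi>)"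
  let ?e = "BFC_group G \<and>
    finite (carrier (int_tensor_product (abelianization G) (abelianization G)))"
  let ?f = "finite (tensors G G\<phi> \<phi>)"
  interpret V: tensor_pair ?V G "nu_base G G\<phi> \<phi>" "nu_copy G G\<phi> \<phi>"
    by (rule nu_tensor_pair[OF assms])
  have T: "tensors G G\<phi> \<phi> = V.tensors_of (carrier G)" by (rule tensors_eq[OF assms])
  have ab: "BFC_group ?V \<longleftrightarrow> ?b"
    using V.K.BFC_imp_finite_commutators V.K.finite_commutators_imp_BFC by blast
  have bc: "?b \<longleftrightarrow> ?c"
    using V.K.finite_commutators_imp_finite_derived V.K.finite_derived_imp_finite_commutators
    by blast
  have "nonabelian_tensor_square G G\<phi> \<phi> \<subseteq> derived ?V (carrier ?V)"
    unfolding nonabelian_tensor_square_def T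
    by (intro V.K.generate_subgroup_incl V.K.derived_is_subgroup)
      (auto intro: V.K.commutator_in_derived)
  then have cd: "?c \<Longrightarrow> ?d" by (rule finite_subset)
  have db: "?d \<Longrightarrow> ?b" by (rule finite_nu_commutators_if_finite_tensor_square[OF assms])
  have fd: "?f \<Longrightarrow> ?d"
    unfolding nonabelian_tensor_square_def T by (rule V.finite_generate_tensors)
  have "tensors G G\<phi> \<phi> \<subseteq> nonabelian_tensor_square G G\<phi> \<phi>"
    unfolding nonabelian_tensor_square_def by (blast intro: generate.incl)
  then have df: "?d \<Longrightarrow> ?f" by (rule finite_subset)
  have fe: "?f \<Longrightarrow> ?e"
    using finite_tensor_product_if_finite_tensors[OF assms]
      V.G.finite_commutators_imp_BFC[OF finite_commutators_if_finite_tensors[OF assms]] by blast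
  have ed: "?e \<Longrightarrow> ?d"
    unfolding nonabelian_tensor_square_def T by (blast intro: V.finite_tensor_square_if_BFC)
  show ?thesis
    unfolding Let_def using ab bc cd db fd df fe ed by argo
qed

end
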